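(* Let $n\ge 3$ and let $Y=\mu+\sigma\varepsilon$ with $\mu\in\mathbb{R}^n$, $\sigma>0$ (unknown) and $\varepsilon$ a standard Gaussian vector in $\mathbb{R}^n$. Let $\{\mathcal S_m,\ m\in\mathcal M\}$ be a finite collection of linear subspaces of $\mathbb{R}^n$, all contained in a linear subspace $\mathcal S_*\subset\mathbb{R}^n$ of dimension $d_*<n$, and put $N_*=n-d_*$. Let $\{\pi_m,\ m\in\mathcal M\}$ be a probability distribution on $\mathcal M$, $\{L_m,\ m\in\mathcal M\}$ non-negative numbers, $\beta>0$, and let $\hat\mu$ be the mixed estimator with weights $w_m$ defined in the context. Assume that $$\beta<\tfrac14,\qquad N_*\ \ge\ 2+\frac{\log n}{\phi(4\beta)},\qquad\text{where }\phi(x)=\tfrac12(x-1-\log x)\ \text{ for }x\in(0,1),$$ and that $L_m\ge \dim(\mathcal S_m)/2$ for all $m\in\mathcal M$. Set $\varepsilon_n=(2n\log n)^{-1}$ and $\bar\sigma^2=\sigma^2+\|\mu-\Pi_{\mathcal S_*}\mu\|^2/N_*$. Then $$\mathbb{E}\big(\|\mu-\hat\mu\|^2\big)\ \le\ -(1+\varepsilon_n)\frac{\bar\sigma^2}{\beta}\log\Big[\sum_{m\in\mathcal M}\pi_m\, e^{-\beta\left[\|\mu-\Pi_{\mathcal S_m}\mu\|^2-\dim(\mathcal S_m)\sigma^2\right]/\bar\sigma^2-L_m}\Big]+\frac{\sigma^2}{2\log n}$$ and $$\mathbb{E}\big(\|\mu-\hat\mu\|^2\big)\ \le\ (1+\varepsilon_n)\inf_{m\in\mathcal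 M}\Big\{\|\mu-\Pi_{\mathcal S_m}\mu\|^2+\frac{\bar\sigma^2}{\beta}\big(L_m-\log\pi_m\big)\Big\}+\frac{\sigma^2}{2\log n}.$$
   Context: $\|\cdot\|$ is the Euclidean norm on $\mathbb{R}^n$ and $\Pi_{\mathcal S}$ is the orthogonal projector onto a linear subspace $\mathcal S$. Put $\hat\mu_m=\Pi_{\mathcal S_m}Y$ (least-squares estimator on $\mathcal S_m$) and $$\hat\sigma^2=\frac{\|Y-\Pi_{\mathcal S_*}Y\|^2}{N_*}.$$ It is not assumed that $\mu\in\mathcal S_*$. The mixed estimator is $$\hat\mu=\sum_{m\in\mathcal M}w_m\hat\mu_m,\qquad w_m=\frac{\pi_m}{\mathcal Z}\exp\Big(\beta\frac{\|\hat\mu_m\|^2}{\hat\sigma^2}-L_m\Big),$$ where $\mathcal Z$ is the (random) normalizing constant making $\sum_{m\in\mathcal M} w_m=1$. Convention: $-\log 0=+\infty$. *)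

theory Defs
  imports "HOL-Probability.Probability"
begin

definition orth_proj :: "'a::real_inner set \<Rightarrow> 'a \<Rightarrow> 'a" where
  "orth_proj S x = (THE p. p \<in> S \<and> (\<forall>y\<in>S. orthogonal (x - p) y))"

lemma orth_proj_ex1:
  fixes S :: "'a::euclidean_space set"
  assumes "subspace S"
  shows "\<exists>!p. p \<in> S \<and> (\<forall>y\<in>S. orthogonal (x - p) y)"
proof (rule ex_ex1I)
  obtain p z where "p \<in> span S" "\<And>w. w \<in> span S \<Longrightarrow> orthogonal z w" "x = p + z"
    using orthogonal_subspace_decomp_exists[of S x] by blast
  moreover have "span S = S"
    using assms by (simp add: span_eq_iff)
  ultimately show "\<exists>p. p \<in> S \<and> (\<forall>y\<in>S. orthogonal (x - p) y)"
    by (intro exI[of _ p]) auto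
next
  fix p q
  assume p: "p \<in> S \<and> (\<forall>y\<in>S. orthogonal (x - p) y)"
    and q: "q \<in> S \<and> (\<forall>y\<in>S. orthogonal (x - q) y)"
  have "p - q \<in> S"
    using p q assms by (simp add: subspace_diff)
  then have "(x - q) \<bullet> (p - q) - (x - p) \<bullet> (p - q) = 0"
    using p q by (simp add: orthogonal_def)
  then have "(p - q) \<bullet> (p - q) = 0"
    by (simp add: inner_diff_left)
  then show "p = q"
    by simp
qed

definition standard_gaussian :: "'w measure \<Rightarrow> ('w \<Rightarrow> real ^ 'n) \<Rightarrow> bool" where
  "standard_gaussian P X \<longleftrightarrow>
     prob_space.indep_vars P (\<lambda>_. borel) (\<lambda>i \<omega>. X \<omega> $ i) UNIV \<and>
     (\<forall>i. distributed P lborel (\<lambda>\<omega>. X \<omega> $ i) std_normal_density)"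

definition phi :: "real \<Rightarrow> real" where
  "phi x = (x - 1 - ln x) / 2"

text \<open>The function \<open>- log\<close> on \<open>[0, 1]\<close> with the convention \<open>- log 0 = \<infinity>\<close>
  (whereas \<open>ln 0 = 0\<close> in the library).\<close>
definition neg_log :: "real \<Rightarrow> ereal" where
  "neg_log x = (if x = 0 then \<infinity> else ereal (- ln x))"

definition resid_dim :: "(real ^ 'n) set \<Rightarrow> nat" where
  "resid_dim S = CARD('n) - dim S"

text \<open>When \<open>y \<in> Sstar\<close>, the variance estimate vanishes and the quotient in \<open>raw_weight\<close> is
  0 by convention; if \<open>dim Sstar < CARD('n)\<close> this is a null event for Gaussian data.\<close>
definition var_est :: "(real ^ 'n) set \<Rightarrow> real ^ 'n \<Rightarrow> real" where
  "var_est Sstar y = (norm (y - orth_proj Sstar y))\<^sup>2 / real (resid_dim Sstar)"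

definition raw_weight ::
  "(real ^ 'n) set \<Rightarrow> ('m \<Rightarrow> (real ^ 'n) set) \<Rightarrow> ('m \<Rightarrow> real) \<Rightarrow> ('m \<Rightarrow> real) \<Rightarrow> real
     \<Rightarrow> real ^ 'n \<Rightarrow> 'm \<Rightarrow> real" where
  "raw_weight Sstar S \<pi> L \<beta> y m =
     \<pi> m * exp (\<beta> * ((norm (orth_proj (S m) y))\<^sup>2 / var_est Sstar y) - L m)"

definition mix_weight ::
  "(real ^ 'n) set \<Rightarrow> 'm set \<Rightarrow> ('m \<Rightarrow> (real ^ 'n) set) \<Rightarrow> ('m \<Rightarrow> real) \<Rightarrow> ('m \<Rightarrow> real) \<Rightarrow> real
     \<Rightarrow> real ^ 'n \<Rightarrow> 'm \<Rightarrow> real" where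
  "mix_weight Sstar M S \<pi> L \<beta> y m =
     raw_weight Sstar S \<pi> L \<beta> y m / (\<Sum>k\<in>M. raw_weight Sstar S \<pi> L \<beta> y k)"

definition mixed_estimator ::
  "(real ^ 'n) set \<Rightarrow> 'm set \<Rightarrow> ('m \<Rightarrow> (real ^ 'n) set) \<Rightarrow> ('m \<Rightarrow> real) \<Rightarrow> ('m \<Rightarrow> real) \<Rightarrow> real
     \<Rightarrow> real ^ 'n \<Rightarrow> real ^ 'n" where
  "mixed_estimator Sstar M S \<pi> L \<beta> y =
     (\<Sum>m\<in>M. mix_weight Sstar M S \<pi> L \<beta> y m *\<^sub>R orth_proj (S m) y)"

end

theory Submission
  imports Defs "HOL-Real_Asymp.Real_Asymp"
begin

text \<open>The residual \<open>Y - orth_proj Sstar Y\<close> and \<open>orth_proj Sstar Y\<close> are independent, so one may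
  condition on the variance estimate \<open>s\<close> and treat the weights as Gibbs weights at the fixed inverse
  temperature \<open>\<beta> / s\<close>. Stein's identity then gives an unbiased estimate of the risk. Since
  \<open>L m \<ge> dim (S m) / 2\<close>, the Gibbs variational principle bounds it, for every competing
  distribution \<open>q\<close> on the models, by \<open>max 1 (4 \<beta> \<sigma>\<^sup>2 / s)\<close> times the free energy of \<open>q\<close>, which
  is affine in \<open>s\<close>. It remains to average over \<open>s\<close>: the excess of \<open>max 1 (4 \<beta> \<sigma>\<^sup>2 / s)\<close>
  over 1 has mean at most \<open>\<epsilon>\<^sub>n\<close>, by an exponential Markov bound based on the Laplace transform of
  the squared norm of the residual, and the optimal \<open>q\<close> yields the logarithm in the first bound.
  The second bound keeps a single summand of that logarithm.\<close>

section \<open>Standard Gaussian vectors\<close>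

text \<open>The obstacle is that the temperature of the weights is random, and differentiating
  through the variance estimate would add unwanted terms to Stein's identity. The weights see the
  data only through projections inside \<open>Sstar\<close> and through the residual, so once the
  residual is frozen the rest may be replaced by a full standard Gaussian vector. The factor 4
  \<beta> \<sigma>^2 / s is 2 \<sigma>^2 from Stein's identity times twice the inverse temperature
  \<beta> / s, which comes from differentiating a squared norm. Averaging over s meets the product
  of the excess and an affine function of s; it can be linearised because the excess is nonzero only
  where s is below \<sigma>^2, hence below the mean of s. The free energy is measured relative to
  the projection onto \<open>Sstar\<close>, which makes its parts nonnegative, so that the bound on
  the mean excess may be multiplied by them. The price of this normalisation is \<epsilon>_n times
  at most n \<sigma>^2, and since \<epsilon>_n = 1 / (2 n log n) this is the remainder \<sigma>^2 /
  (2 log n).\<close>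

lemma nn_integral_lborel_translation:
  fixes f :: "'a::euclidean_space \<Rightarrow> ennreal"
  assumes [measurable]: "f \<in> borel_measurable borel"
  shows "(\<integral>\<^sup>+x. f (c + x) \<partial>lborel) = (\<integral>\<^sup>+x. f x \<partial>lborel)"
proof -
  have "(\<integral>\<^sup>+x. f x \<partial>lborel) = (\<integral>\<^sup>+x. f x \<partial>distr lborel borel ((+) c))"
    by (simp add: lborel_distr_plus)
  also have "\<dots> = (\<integral>\<^sup>+x. f (c + x) \<partial>lborel)"
    by (subst nn_integral_distr) auto
  finally show ?thesis by simp
qed

lemma orthogonal_transformation_borel_measurable:
  fixes T :: "'a::euclidean_space \<Rightarrow> 'a"
  assumes "orthogonal_transformation T"
  shows "T \<in> borel_measurable borel"
  by (intro borel_measurable_continuous_onI linear_continuous_on)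
     (use assms in \<open>simp add: orthogonal_transformation_linear linear_conv_bounded_linear[symmetric]\<close>)

text \<open>The library proves this only for index types of class \<open>wellorder\<close>. Here Tonelli's
  theorem for \<open>indicator (ball 0 1) (x - T y) * g (T y)\<close>, integrated in both orders, gives the
  invariance, because the unit ball is preserved by \<open>T\<close>.\<close>

lemma nn_integral_lborel_orthogonal:
  fixes T :: "'a::euclidean_space \<Rightarrow> 'a" and g :: "'a \<Rightarrow> ennreal"
  assumes T: "orthogonal_transformation T" and [measurable]: "g \<in> borel_measurable borel"
  shows "(\<integral>\<^sup>+y. g (T y) \<partial>lborel) = (\<integral>\<^sup>+y. g y \<partial>lborel)"
proof -
  note [measurable] = orthogonal_transformation_borel_measurable[OF T]
  have Tadd: "T (a + b) = T a + T b" for a b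
    using T by (simp add: orthogonal_transformation_linear linear_add)
  have Tn: "norm (T a) = norm a" for a
    using T by (simp add: orthogonal_transformation)
  define f :: "'a \<Rightarrow> ennreal" where "f = indicator (ball 0 1)"
  have [measurable]: "f \<in> borel_measurable borel" unfolding f_def by (rule borel_measurable_indicator) simp
  have fT: "f (- T y) = f y" for y
    by (simp add: f_def indicator_def Tn)
  let ?F = "\<integral>\<^sup>+x. f x \<partial>lborel"
  have tr: "(\<integral>\<^sup>+x. f (c + x) \<partial>lborel) = ?F" for c
    by (rule nn_integral_lborel_translation) measurable
  have F: "?F = emeasure lborel (ball (0::'a) 1)" by (simp add: f_def)
  have "?F * (\<integral>\<^sup>+y. g (T y) \<partial>lborel) = (\<integral>\<^sup>+y. (\<integral>\<^sup>+x. f (- T y + x) \<partial>lborel) * g (T y) \<partial>lborel)"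
    by (simp only: tr) (simp add: nn_integral_cmult)
  also have "\<dots> = (\<integral>\<^sup>+y. \<integral>\<^sup>+x. f (- T y + x) * g (T y) \<partial>lborel \<partial>lborel)"
    by (simp add: nn_integral_multc)
  also have "\<dots> = (\<integral>\<^sup>+x. \<integral>\<^sup>+y. f (- T y + x) * g (T y) \<partial>lborel \<partial>lborel)"
    by (rule lborel_pair.Fubini') measurable
  also have "\<dots> = (\<integral>\<^sup>+x. \<integral>\<^sup>+y. f (- T y) * g (T y + x) \<partial>lborel \<partial>lborel)"
  proof (rule nn_integral_cong)
    \<comment> \<open>Substituting \<open>c + y\<close> with \<open>T c = x\<close> gives
      \<open>T (c + y) = x + T y\<close>, so \<open>x\<close> leaves the ball indicator and enters
      \<open>g\<close>.\<close>
    fix x :: 'a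
    obtain c where c: "T c = x"
      using orthogonal_transformation_surj[OF T] by (metis surjD)
    have "(\<integral>\<^sup>+y. f (- T y + x) * g (T y) \<partial>lborel) = (\<integral>\<^sup>+y. f (- T (c + y) + x) * g (T (c + y)) \<partial>lborel)"
      by (rule nn_integral_lborel_translation[symmetric]) measurable
    then show "(\<integral>\<^sup>+y. f (- T y + x) * g (T y) \<partial>lborel) = (\<integral>\<^sup>+y. f (- T y) * g (T y + x) \<partial>lborel)"
      by (simp add: Tadd c add.commute)
  qed
  also have "\<dots> = (\<integral>\<^sup>+y. \<integral>\<^sup>+x. f (- T y) * g (T y + x) \<partial>lborel \<partial>lborel)"
    by (rule lborel_pair.Fubini') measurable
  also have "\<dots> = (\<integral>\<^sup>+y. f (- T y) * (\<integral>\<^sup>+x. g x \<partial>lborel) \<partial>lborel)"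
    by (simp add: nn_integral_cmult nn_integral_lborel_translation)
  also have "\<dots> = ?F * (\<integral>\<^sup>+x. g x \<partial>lborel)"
    by (simp add: nn_integral_multc fT)
  finally have eq: "?F * (\<integral>\<^sup>+y. g (T y) \<partial>lborel) = ?F * (\<integral>\<^sup>+x. g x \<partial>lborel)" .
  have "?F < \<infinity>" unfolding F
    by (metis emeasure_lborel_ball_finite infinity_ennreal_def)
  moreover have "?F \<noteq> 0" unfolding F
    using emeasure_lborel_cbox_eq
    by (metis ball_eq_empty content_ball_pos emeasure_eq_measure2 emeasure_lborel_ball_finite ennreal_0 measure_def less_irrefl enn2real_0 less_numeral_extra(1))
  ultimately show ?thesis
    using eq by (metis ennreal_mult_cancel_left infinity_ennreal_def less_irrefl)
qed

section \<open>Product and density descriptions of the standard Gaussian law\<close>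

abbreviation std_normal :: "real measure" where
  "std_normal \<equiv> density lborel (\<lambda>x. ennreal (std_normal_density x))"

text \<open>Encoded as an image of a product measure: Fubini over coordinates is inherited from the
  product, while rotations and projections act on the vector space.\<close>

definition std_gauss :: "(real ^ 'n) measure" where
  "std_gauss = distr (\<Pi>\<^sub>M i\<in>UNIV. std_normal) borel vec_lambda"

interpretation std_normal: prob_space std_normal
  by (rule prob_space_normal_density) simp

interpretation normal_prod: product_sigma_finite "\<lambda>i. std_normal"
  by (simp add: product_sigma_finite_def std_normal.sigma_finite_measure_axioms)

lemma vec_lambda_measurable [measurable]:
  "(vec_lambda :: _ \<Rightarrow> real ^ 'n) \<in> borel_measurable (\<Pi>\<^sub>M i\<in>UNIV. std_normal)"
proof (subst borel_measurable_euclidean_space, intro ballI)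
  fix b :: "real ^ 'n" assume "b \<in> Basis"
  then obtain i where b: "b = axis i 1" by (auto simp: Basis_vec_def)
  have "(\<lambda>x. x i) \<in> (\<Pi>\<^sub>M i\<in>(UNIV::'n set). std_normal) \<rightarrow>\<^sub>M std_normal"
    by (rule measurable_component_singleton) simp
  then show "(\<lambda>x. vec_lambda x \<bullet> b) \<in> borel_measurable (\<Pi>\<^sub>M i\<in>UNIV. std_normal)"
    by (simp add: b inner_axis)
qed

lemma sets_std_gauss [measurable_cong, simp]: "sets std_gauss = sets borel"
  by (simp add: std_gauss_def)

lemma space_std_gauss [simp]: "space std_gauss = UNIV"
  by (simp add: std_gauss_def)

lemma prob_space_std_gauss: "prob_space (std_gauss :: (real ^ 'n) measure)"
  unfolding std_gauss_def
  by (intro prob_space.prob_space_distr prob_space_PiM) (simp_all add: std_normal.prob_space_axioms)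

text \<open>Independence means that the joint law of the coordinates is the product of their laws,
  which is the measure behind \<open>std_gauss\<close>. This transports expectations from the
  abstract probability space to a concrete one.\<close>

lemma distr_standard_gaussian:
  fixes X :: "'w \<Rightarrow> real ^ 'n"
  assumes P: "prob_space P" and X: "standard_gaussian P X"
  shows "X \<in> borel_measurable P" "distr P borel X = std_gauss"
proof -
  interpret prob_space P by fact
  have d: "distributed P lborel (\<lambda>\<omega>. X \<omega> $ i) std_normal_density" for i
    using X by (simp add: standard_gaussian_def)
  have rv: "(\<lambda>\<omega>. X \<omega> $ i) \<in> borel_measurable P" for i
    using distributed_measurable[OF d[of i]] by simp
  show meas: "X \<in> borel_measurable P"
  proof (subst borel_measurable_euclidean_space, intro ballI)
    fix b :: "real ^ 'n" assume "b \<in> Basis"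
    then obtain i where b: "b = axis i 1" by (auto simp: Basis_vec_def)
    show "(\<lambda>x. X x \<bullet> b) \<in> borel_measurable P"
      using rv[of i] by (simp add: b inner_axis)
  qed
  have e: "distr P borel (\<lambda>\<omega>. X \<omega> $ i) = std_normal" for i
    using distributed_distr_eq_density[OF d[of i]]
    by (metis (no_types, lifting) distr_cong sets_lborel)
  have "distr P (\<Pi>\<^sub>M i\<in>UNIV. borel) (\<lambda>\<omega>. \<lambda>i\<in>UNIV. X \<omega> $ i) = (\<Pi>\<^sub>M i\<in>UNIV. distr P borel (\<lambda>\<omega>. X \<omega> $ i))"
    using X rv by (subst indep_vars_iff_distr_eq_PiM[symmetric]) (auto simp: standard_gaussian_def)
  then have j: "distr P (\<Pi>\<^sub>M i\<in>UNIV. std_normal) (\<lambda>\<omega> i. X \<omega> $ i) = (\<Pi>\<^sub>M i\<in>UNIV. std_normal)"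
    by (simp add: e restrict_UNIV cong: distr_cong sets_PiM_cong)
  have m: "(\<lambda>\<omega> i. X \<omega> $ i) \<in> P \<rightarrow>\<^sub>M (\<Pi>\<^sub>M i\<in>UNIV. std_normal)"
    by (rule measurable_PiM_single') (use rv in auto)
  show "distr P borel X = std_gauss"
    unfolding std_gauss_def
    by (subst j[symmetric], subst distr_distr[OF vec_lambda_measurable m]) (simp add: comp_def)
qed

text \<open>The measure with density is pushed to the product space and compared with the product
  measure on boxes. The density is wanted for rotation invariance, which the product form
  hides.\<close>

lemma std_gauss_eq_density:
  "(std_gauss :: (real ^ 'n) measure) =
     density lborel (\<lambda>x. ennreal (\<Prod>i\<in>UNIV. std_normal_density (x $ i)))"
proof -
  let ?D = "density lborel (\<lambda>x::real^'n. ennreal (\<Prod>i\<in>UNIV. std_normal_density (x $ i)))"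
  let ?N = "\<Pi>\<^sub>M i\<in>(UNIV::'n set). std_normal"
  have m: "(\<lambda>x i. x $ i) \<in> ?D \<rightarrow>\<^sub>M ?N"
    by (rule measurable_PiM_single') auto
  have "distr ?D ?N (\<lambda>x i. x $ i) = ?N"
  proof (rule normal_prod.PiM_eqI)
    fix A :: "'n \<Rightarrow> real set"
    assume "\<And>i. i \<in> UNIV \<Longrightarrow> A i \<in> sets std_normal"
    then have A[measurable]: "A i \<in> sets borel" for i by simp
    have "emeasure (distr ?D ?N (\<lambda>x i. x $ i)) (Pi\<^sub>E UNIV A)
        = emeasure ?D {x. \<forall>i. x $ i \<in> A i}"
      by (subst emeasure_distr[OF m]) (auto intro!: sets_PiM_I_finite arg_cong[where f="emeasure ?D"])
    also have "\<dots> = (\<integral>\<^sup>+x. ennreal (\<Prod>i\<in>UNIV. std_normal_density (x $ i)) * indicator {x. \<forall>i. x $ i \<in> A i} x \<partial>lborel)"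
      by (rule emeasure_density) measurable
    \<comment> \<open>Lebesgue measure factors over \<open>Basis\<close>, the density over the index
      type. The inner product over \<open>{i. axis i 1 = b}\<close> has exactly one factor for each
      basis vector \<open>b\<close>, which converts the indexing without an explicit inverse of
      \<open>axis\<close>.\<close>
    also have "\<dots> = (\<integral>\<^sup>+x. (\<Prod>b\<in>Basis. (\<lambda>z. \<Prod>i\<in>{i. axis i (1::real) = b}. ennreal (std_normal_density z) * indicator (A i) z) (x \<bullet> b)) \<partial>lborel)"
    proof (rule nn_integral_cong)
      fix x :: "real ^ 'n"
      have "ennreal (\<Prod>i\<in>UNIV. std_normal_density (x $ i)) * indicator {x. \<forall>i. x $ i \<in> A i} x
          = (\<Prod>i\<in>UNIV. ennreal (std_normal_density (x $ i)) * indicator (A i) (x $ i))"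
        by (auto simp: prod.distrib prod_ennreal indicator_def prod_zero_iff split: if_splits)
      also have "\<dots> = (\<Prod>b\<in>range (\<lambda>i. axis i (1::real)). \<Prod>i\<in>{i\<in>UNIV. axis i 1 = b}. ennreal (std_normal_density (x $ i)) * indicator (A i) (x $ i))"
        by (rule prod.image_gen) simp
      also have "range (\<lambda>i. axis i (1::real)) = (Basis :: (real ^ 'n) set)"
        by (auto simp: Basis_vec_def)
      finally show "ennreal (\<Prod>i\<in>UNIV. std_normal_density (x $ i)) * indicator {x. \<forall>i. x $ i \<in> A i} x
          = (\<Prod>b\<in>Basis. (\<lambda>z. \<Prod>i\<in>{i. axis i (1::real) = b}. ennreal (std_normal_density z) * indicator (A i) z) (x \<bullet> b))"
        by (auto intro!: prod.cong simp: inner_axis)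
    qed
    also have "\<dots> = (\<Prod>b\<in>(Basis::(real^'n) set). \<integral>\<^sup>+z. (\<Prod>i\<in>{i. axis i 1 = b}. ennreal (std_normal_density z) * indicator (A i) z) \<partial>lborel)"
      by (subst nn_integral_lborel_prod) auto
    also have "(Basis::(real^'n) set) = range (\<lambda>i. axis i 1)"
      by (auto simp: Basis_vec_def)
    also have "(\<Prod>b\<in>range (\<lambda>i::'n. axis i (1::real)). \<integral>\<^sup>+z. (\<Prod>i\<in>{i. axis i 1 = b}. ennreal (std_normal_density z) * indicator (A i) z) \<partial>lborel)
       = (\<Prod>i\<in>UNIV. \<integral>\<^sup>+z. ennreal (std_normal_density z) * indicator (A i) z \<partial>lborel)"
      by (subst prod.reindex) (auto intro!: prod.cong simp: inj_on_def axis_eq_axis)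
    also have "\<dots> = (\<Prod>i\<in>UNIV. emeasure std_normal (A i))"
      by (intro prod.cong emeasure_density[symmetric]) auto
    finally show "emeasure (distr ?D ?N (\<lambda>x i. x $ i)) (Pi\<^sub>E UNIV A) = (\<Prod>i\<in>UNIV. emeasure std_normal (A i))" .
  qed auto
  then have "std_gauss = distr (distr ?D ?N (\<lambda>x i. x $ i)) borel vec_lambda"
    by (simp add: std_gauss_def)
  also have "\<dots> = distr ?D borel (\<lambda>x. x)"
    by (subst distr_distr[OF vec_lambda_measurable m]) (simp add: comp_def)
  also have "\<dots> = ?D"
    by (rule distr_id2) simp
  finally show ?thesis .
qed

lemma prod_std_normal_density:
  "(\<Prod>i\<in>UNIV. std_normal_density ((x::real^'n) $ i)) = (1 / sqrt (2 * pi)) ^ CARD('n) * exp (- (norm x)\<^sup>2 / 2)"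
proof -
  have "(norm x)\<^sup>2 = (\<Sum>i\<in>UNIV. (x $ i)\<^sup>2)"
    unfolding power2_norm_eq_inner inner_vec_def by (simp add: power2_eq_square)
  then have "- (norm x)\<^sup>2 / 2 = (\<Sum>i\<in>UNIV. - (x $ i)\<^sup>2 / 2)"
    by (simp add: sum_negf sum_divide_distrib)
  then have "exp (- (norm x)\<^sup>2 / 2) = (\<Prod>i\<in>UNIV. exp (- (x $ i)\<^sup>2 / 2))"
    by (simp only: exp_sum[OF finite])
  then show ?thesis
    unfolding std_normal_density_def prod.distrib by simp
qed

text \<open>The Gaussian density depends on the norm alone, and Lebesgue measure is invariant under
  \<open>T\<close>.\<close>

lemma nn_integral_std_gauss_orthogonal:
  fixes T :: "real ^ 'n \<Rightarrow> real ^ 'n" and g :: "real ^ 'n \<Rightarrow> ennreal"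
  assumes T: "orthogonal_transformation T" and [measurable]: "g \<in> borel_measurable borel"
  shows "(\<integral>\<^sup>+x. g (T x) \<partial>std_gauss) = (\<integral>\<^sup>+x. g x \<partial>std_gauss)"
proof -
  note [measurable] = orthogonal_transformation_borel_measurable[OF T]
  have Tn: "norm (T a) = norm a" for a
    using T by (simp add: orthogonal_transformation)
  let ?d = "\<lambda>x::real^'n. ennreal ((1 / sqrt (2 * pi)) ^ CARD('n) * exp (- (norm x)\<^sup>2 / 2))"
  have "(\<integral>\<^sup>+x. g (T x) \<partial>std_gauss) = (\<integral>\<^sup>+x. ?d (T x) * g (T x) \<partial>lborel)"
    unfolding std_gauss_eq_density prod_std_normal_density
    by (subst nn_integral_density) (auto simp: Tn)
  also have "\<dots> = (\<integral>\<^sup>+x. ?d x * g x \<partial>lborel)"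
    by (rule nn_integral_lborel_orthogonal[OF T]) measurable
  also have "\<dots> = (\<integral>\<^sup>+x. g x \<partial>std_gauss)"
    unfolding std_gauss_eq_density prod_std_normal_density
    by (subst nn_integral_density) auto
  finally show ?thesis .
qed

section \<open>Orthogonal projections of Gaussian vectors\<close>

lemma orth_proj_mem:
  fixes S :: "'a::euclidean_space set"
  assumes "subspace S" shows "orth_proj S x \<in> S"
  using theI'[OF orth_proj_ex1[OF assms]] by (simp add: orth_proj_def)

lemma orth_proj_orthogonal:
  fixes S :: "'a::euclidean_space set"
  assumes "subspace S" "y \<in> S" shows "(x - orth_proj S x) \<bullet> y = 0"
  using theI'[OF orth_proj_ex1[OF assms(1)]] assms(2) by (simp add: orth_proj_def orthogonal_def)

lemma orth_proj_unique:
  fixes S :: "'a::euclidean_space set"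
  assumes "subspace S" "p \<in> S" "\<And>y. y \<in> S \<Longrightarrow> (x - p) \<bullet> y = 0"
  shows "orth_proj S x = p"
  unfolding orth_proj_def
  by (rule the1_equality[OF orth_proj_ex1[OF assms(1)]]) (use assms in \<open>auto simp: orthogonal_def\<close>)

lemma orth_proj_inner:
  fixes S :: "'a::euclidean_space set"
  assumes "subspace S" "y \<in> S" shows "orth_proj S x \<bullet> y = x \<bullet> y"
  using orth_proj_orthogonal[OF assms, of x] by (simp add: inner_diff_left)

lemma orth_proj_self:
  fixes S :: "'a::euclidean_space set"
  assumes "subspace S" "x \<in> S" shows "orth_proj S x = x"
  by (rule orth_proj_unique) (use assms in auto)

lemma linear_orth_proj:
  fixes S :: "'a::euclidean_space set"
  assumes S: "subspace S" shows "linear (orth_proj S)"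
proof (rule linearI)
  show "orth_proj S (x + y) = orth_proj S x + orth_proj S y" for x y
    by (rule orth_proj_unique[OF S])
       (simp_all add: S orth_proj_mem subspace_add inner_diff_left inner_add_left orth_proj_inner)
  show "orth_proj S (c *\<^sub>R x) = c *\<^sub>R orth_proj S x" for c x
    by (rule orth_proj_unique[OF S])
       (simp_all add: S orth_proj_mem subspace_scale inner_diff_left orth_proj_inner)
qed

lemma orth_proj_add:
  fixes S :: "'a::euclidean_space set"
  assumes "subspace S" shows "orth_proj S (x + y) = orth_proj S x + orth_proj S y"
  using linear_orth_proj[OF assms] by (rule linear_add)

lemma orth_proj_scaleR:
  fixes S :: "'a::euclidean_space set"
  assumes "subspace S" shows "orth_proj S (c *\<^sub>R x) = c *\<^sub>R orth_proj S x"
  using linear_orth_proj[OF assms] by (rule linear_scale)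

lemma orth_proj_selfadjoint:
  fixes S :: "'a::euclidean_space set"
  assumes "subspace S" shows "orth_proj S x \<bullet> y = x \<bullet> orth_proj S y"
  by (metis assms inner_commute orth_proj_inner orth_proj_mem)

lemma orth_proj_inner_self:
  fixes S :: "'a::euclidean_space set"
  assumes "subspace S" shows "x \<bullet> orth_proj S x = (norm (orth_proj S x))\<^sup>2"
  by (metis assms orth_proj_inner orth_proj_mem power2_norm_eq_inner)

lemma norm_diff_orth_proj:
  fixes S :: "'a::euclidean_space set"
  assumes "subspace S" shows "(norm (x - orth_proj S x))\<^sup>2 = (norm x)\<^sup>2 - (norm (orth_proj S x))\<^sup>2"
  using orth_proj_inner_self[OF assms, of x]
  by (simp add: power2_norm_eq_inner inner_diff_left inner_diff_right inner_commute)

lemma norm_orth_proj_le: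
  fixes S :: "'a::euclidean_space set"
  assumes "subspace S" shows "norm (orth_proj S x) \<le> norm x"
proof (rule power2_le_imp_le)
  show "(norm (orth_proj S x))\<^sup>2 \<le> (norm x)\<^sup>2"
    using norm_diff_orth_proj[OF assms, of x] zero_le_power2[of "norm (x - orth_proj S x)"] by linarith
qed simp

lemma orth_proj_nested:
  fixes S :: "'a::euclidean_space set"
  assumes "subspace S" "subspace T" "S \<subseteq> T" shows "orth_proj S (orth_proj T x) = orth_proj S x"
  using assms
  by (intro orth_proj_unique) (auto simp: orth_proj_mem inner_diff_left orth_proj_inner subset_iff)

lemma orth_proj_measurable [measurable]:
  fixes S :: "'a::euclidean_space set"
  assumes "subspace S" shows "orth_proj S \<in> borel_measurable borel"
  using linear_orth_proj[OF assms]
  by (intro borel_measurable_continuous_onI linear_continuous_on)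
     (simp add: linear_conv_bounded_linear[symmetric])

text \<open>Orthonormal bases of \<open>S\<close> and of its orthogonal complement are joined; their
  cardinalities add up to the full dimension. Indexing by the coordinate type makes the coefficients
  a vector of the same type, and \<open>J\<close> marks the part that spans
  \<open>S\<close>.\<close>

lemma adapted_orthonormal_basis:
  fixes S :: "(real ^ 'n) set"
  assumes S: "subspace S"
  obtains u :: "'n \<Rightarrow> real ^ 'n" and J
  where "\<And>i j. u i \<bullet> u j = (if i = j then 1 else 0)" "card J = dim S"
    and "\<And>x. x = (\<Sum>i\<in>UNIV. (x \<bullet> u i) *\<^sub>R u i)"
    and "\<And>x. orth_proj S x = (\<Sum>i\<in>J. (x \<bullet> u i) *\<^sub>R u i)"
proof -
  let ?C = "{y \<in> UNIV. \<forall>x\<in>S. orthogonal x y}"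
  have sC: "subspace ?C"
    using subspace_orthogonal_to_vectors[of S] by simp
  obtain B where B: "B \<subseteq> S" "pairwise orthogonal B" "\<And>x. x \<in> B \<Longrightarrow> norm x = 1"
      "independent B" "card B = dim S" "span B = S"
    using orthonormal_basis_subspace[OF S] by blast
  obtain C where C: "C \<subseteq> ?C" "pairwise orthogonal C" "\<And>x. x \<in> C \<Longrightarrow> norm x = 1"
      "independent C" "card C = dim ?C" "span C = ?C"
    using orthonormal_basis_subspace[OF sC] by blast
  have fin: "finite B" "finite C"
    using B(4) C(4) independent_imp_finite by blast+
  have BC: "orthogonal x y" if "x \<in> B" "y \<in> C" for x y
    using that B(1) C(1) by blast
  have disj: "B \<inter> C = {}"
  proof (rule ccontr)
    assume "B \<inter> C \<noteq> {}"
    then obtain x where "x \<in> B" "x \<in> C" by blast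
    then have "orthogonal x x" "norm x = 1" using BC B(3) by auto
    then show False by (simp add: orthogonal_def norm_eq_1)
  qed
  have "dim ?C + dim S = CARD('n)"
    using dim_subspace_orthogonal_to_vectors[OF S subspace_UNIV] by simp
  then have "card (B \<union> C) = card (UNIV :: 'n set)"
    using fin disj B(5) C(5) by (simp add: card_Un_disjoint)
  then obtain u where u: "bij_betw u (UNIV :: 'n set) (B \<union> C)"
    using fin finite_same_card_bij[of "UNIV :: 'n set" "B \<union> C"] by auto
  define J where "J = {i. u i \<in> B}"
  have uJ: "bij_betw u J B"
    using u unfolding bij_betw_def J_def by (auto simp: inj_on_def)
  have uin: "u i \<in> B \<union> C" for i using u by (auto simp: bij_betw_def)
  have orth: "orthogonal x y" if "x \<in> B \<union> C" "y \<in> B \<union> C" "x \<noteq> y" for x y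
    using that B(2) C(2) BC orthogonal_commute unfolding pairwise_def by blast
  have on: "u i \<bullet> u j = (if i = j then 1 else 0)" for i j
  proof (cases "i = j")
    case True
    then show ?thesis using uin[of i] B(3) C(3) by (auto simp: norm_eq_1)
  next
    case False
    then have "u i \<noteq> u j" using u by (auto simp: bij_betw_def inj_on_def)
    then show ?thesis using orth[OF uin uin] False by (simp add: orthogonal_def)
  qed
  have P: "orth_proj S x = (\<Sum>i\<in>J. (x \<bullet> u i) *\<^sub>R u i)" for x
  proof (rule orth_proj_unique[OF S])
    show "(\<Sum>i\<in>J. (x \<bullet> u i) *\<^sub>R u i) \<in> S"
      using B(1) by (intro subspace_sum subspace_scale S) (auto simp: J_def)
    fix y assume "y \<in> S"
    then have "y \<in> span B" using B(6) by simp
    then show "(x - (\<Sum>i\<in>J. (x \<bullet> u i) *\<^sub>R u i)) \<bullet> y = 0"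
    proof (induction rule: span_induct)
      case base
      then show ?case
        unfolding mem_Collect_eq by (intro subspaceI) (auto simp: inner_add_right)
    next
      case (step b)
      then obtain j where j: "j \<in> J" "b = u j" using uJ by (auto simp: bij_betw_def)
      then show ?case
        by (simp add: inner_diff_left inner_sum_left on if_distrib cong: if_cong)
    qed
  qed
  \<comment> \<open>The remainder \<open>?z\<close> is orthogonal to \<open>span B = S\<close>,
    hence lies in the complement \<open>span C\<close>; being orthogonal to that as well, it is
    orthogonal to itself.\<close>
  have full: "x = (\<Sum>i\<in>UNIV. (x \<bullet> u i) *\<^sub>R u i)" for x
  proof -
    let ?z = "x - (\<Sum>i\<in>UNIV. (x \<bullet> u i) *\<^sub>R u i)"
    have z: "?z \<bullet> u j = 0" for j
      by (simp add: inner_diff_left inner_sum_left on if_distrib cong: if_cong)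
    have zb: "?z \<bullet> b = 0" if "b \<in> B \<union> C" for b
    proof -
      from that u obtain j where "b = u j" by (auto simp: bij_betw_def)
      then show ?thesis by (simp only: z)
    qed
    have "?z \<bullet> y = 0" if "y \<in> span B" for y
      using that
    proof (induction rule: span_induct)
      case base
      show ?case unfolding mem_Collect_eq by (intro subspaceI) (auto simp: inner_add_right)
    next
      case (step b)
      then show ?case by (intro zb) simp
    qed
    then have "?z \<in> ?C" unfolding B(6) by (auto simp: orthogonal_def inner_commute)
    then have "?z \<in> span C" using C(6) by simp
    moreover have "?z \<bullet> y = 0" if "y \<in> span C" for y
      using that
    proof (induction rule: span_induct)
      case base
      show ?case unfolding mem_Collect_eq by (intro subspaceI) (auto simp: inner_add_right)
    next
      case (step b)
      then show ?case by (intro zb) simp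
    qed
    ultimately have "?z \<bullet> ?z = 0" by blast
    then show ?thesis by simp
  qed
  have "card J = dim S" using uJ B(5) by (metis bij_betw_same_card)
  then show thesis using that[OF on _ full P] by blast
qed

text \<open>In an adapted basis the trace is a sum of \<open>dim S\<close> squared unit norms. It is
  the divergence of the projection in Stein's identity.\<close>

lemma trace_orth_proj:
  fixes S :: "(real ^ 'n) set"
  assumes S: "subspace S"
  shows "(\<Sum>i\<in>UNIV. orth_proj S (axis i 1) $ i) = dim S"
proof -
  obtain u :: "'n \<Rightarrow> real ^ 'n" and J
    where u: "\<And>i j. u i \<bullet> u j = (if i = j then 1 else 0)" and cJ: "card J = dim S"
      and full: "\<And>x. x = (\<Sum>i\<in>UNIV. (x \<bullet> u i) *\<^sub>R u i)"
      and P: "\<And>x. orth_proj S x = (\<Sum>i\<in>J. (x \<bullet> u i) *\<^sub>R u i)"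
    by (rule adapted_orthonormal_basis[OF S], rule that, assumption+)
  have "(\<Sum>i\<in>UNIV. orth_proj S (axis i 1) $ i) = (\<Sum>i\<in>UNIV. \<Sum>j\<in>J. u j $ i * u j $ i)"
    by (simp only: P sum_component vector_scaleR_component inner_axis' inner_real_def mult_1 real_scaleR_def)
  also have "\<dots> = (\<Sum>j\<in>J. u j \<bullet> u j)"
    unfolding inner_vec_def inner_real_def by (rule sum.swap)
  also have "\<dots> = dim S" by (simp add: u cJ)
  finally show ?thesis .
qed

lemma orthogonal_transformation_orthonormal:
  fixes u :: "'n \<Rightarrow> real ^ 'n"
  assumes u: "\<And>i j. u i \<bullet> u j = (if i = j then 1 else 0)"
  shows "orthogonal_transformation (\<lambda>x::real^'n. \<Sum>i\<in>UNIV. x $ i *\<^sub>R u i)"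
  unfolding orthogonal_transformation_def
proof (intro conjI allI)
  show "linear (\<lambda>x::real^'n. \<Sum>i\<in>UNIV. x $ i *\<^sub>R u i)"
    by (rule linearI) (simp_all add: scaleR_add_left sum.distrib scaleR_sum_right)
  show "(\<Sum>i\<in>UNIV. v $ i *\<^sub>R u i) \<bullet> (\<Sum>i\<in>UNIV. w $ i *\<^sub>R u i) = v \<bullet> w" for v w :: "real ^ 'n"
  proof -
    have "(\<Sum>i\<in>UNIV. v $ i *\<^sub>R u i) \<bullet> (\<Sum>i\<in>UNIV. w $ i *\<^sub>R u i)
        = (\<Sum>i\<in>UNIV. \<Sum>j\<in>UNIV. if i = j then v $ i * w $ j else 0)"
      unfolding inner_sum_left inner_sum_right
      by (intro sum.cong refl) (simp add: u)
    then show ?thesis by (simp add: inner_vec_def)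
  qed
qed

text \<open>Rotation invariance read in coordinates: the coefficients of a standard Gaussian vector
  in any orthonormal basis are again independent standard normals.\<close>

lemma nn_integral_std_gauss_basis:
  fixes u :: "'n \<Rightarrow> real ^ 'n"
  assumes u: "\<And>i j. u i \<bullet> u j = (if i = j then 1 else 0)"
    and [measurable]: "g \<in> borel_measurable borel"
  shows "(\<integral>\<^sup>+x. g x \<partial>std_gauss) = (\<integral>\<^sup>+z. g (\<Sum>i\<in>UNIV. z i *\<^sub>R u i) \<partial>(\<Pi>\<^sub>M i\<in>UNIV. std_normal))"
proof -
  let ?T = "\<lambda>x::real^'n. \<Sum>i\<in>UNIV. x $ i *\<^sub>R u i"
  have T: "orthogonal_transformation ?T"
    by (rule orthogonal_transformation_orthonormal[OF u])
  have [measurable]: "?T \<in> borel_measurable borel"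
    by (rule orthogonal_transformation_borel_measurable[OF T])
  have "(\<integral>\<^sup>+x. g x \<partial>std_gauss) = (\<integral>\<^sup>+x. g (?T x) \<partial>std_gauss)"
    by (rule nn_integral_std_gauss_orthogonal[OF T, symmetric]) measurable
  also have "\<dots> = (\<integral>\<^sup>+z. g (?T (vec_lambda z)) \<partial>(\<Pi>\<^sub>M i\<in>UNIV. std_normal))"
    unfolding std_gauss_def by (rule nn_integral_distr) measurable
  finally show ?thesis by simp
qed

lemma sum_component_measurable:
  fixes u :: "'i \<Rightarrow> 'a::euclidean_space"
  assumes "finite I"
  shows "(\<lambda>z. \<Sum>i\<in>I. z i *\<^sub>R u i) \<in> borel_measurable (\<Pi>\<^sub>M i\<in>I. std_normal)"
proof (rule borel_measurable_sum)
  fix i assume "i \<in> I"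
  then have "(\<lambda>z. z i) \<in> (\<Pi>\<^sub>M i\<in>I. std_normal) \<rightarrow>\<^sub>M std_normal"
    by (rule measurable_component_singleton)
  then show "(\<lambda>z. z i *\<^sub>R u i) \<in> borel_measurable (\<Pi>\<^sub>M i\<in>I. std_normal)"
    by simp
qed

text \<open>In an adapted basis the projection uses the coordinates in \<open>J\<close> and the
  residual those outside, so the two are independent. Two copies of the whole vector express this,
  so that the inner integral at a frozen residual is again an expectation over
  \<open>std_gauss\<close>.\<close>

lemma nn_integral_std_gauss_split:
  fixes S :: "(real ^ 'n) set" and f :: "real ^ 'n \<Rightarrow> real ^ 'n \<Rightarrow> ennreal"
  assumes S: "subspace S"
    and [measurable]: "(\<lambda>(a, b). f a b) \<in> borel_measurable (borel \<Otimes>\<^sub>M borel)"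
  shows "(\<integral>\<^sup>+x. f (orth_proj S x) (x - orth_proj S x) \<partial>std_gauss) =
    (\<integral>\<^sup>+y. \<integral>\<^sup>+x. f (orth_proj S x) (y - orth_proj S y) \<partial>std_gauss \<partial>std_gauss)"
proof -
  obtain u :: "'n \<Rightarrow> real ^ 'n" and J
    where u: "\<And>i j. u i \<bullet> u j = (if i = j then 1 else 0)" and "card J = dim S"
      and "\<And>x. x = (\<Sum>i\<in>UNIV. (x \<bullet> u i) *\<^sub>R u i)"
      and P: "\<And>x. orth_proj S x = (\<Sum>i\<in>J. (x \<bullet> u i) *\<^sub>R u i)"
    by (rule adapted_orthonormal_basis[OF S], rule that, assumption+)
  note [measurable] = orth_proj_measurable[OF S]
  let ?N = "\<lambda>I::'n set. \<Pi>\<^sub>M i\<in>I. std_normal"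
  let ?s = "\<lambda>I z. \<Sum>i\<in>I. z i *\<^sub>R u i"
  have [measurable]: "?s I \<in> borel_measurable (?N I)" for I
    by (rule sum_component_measurable) simp
  have prob: "emeasure (?N I) (space (?N I)) = 1" for I
    by (intro prob_space.emeasure_space_1 prob_space_PiM std_normal.prob_space_axioms)
  have PT: "orth_proj S (?s UNIV z) = ?s J z" for z
    unfolding P by (simp add: inner_sum_left u if_distrib cong: if_cong)
  have UJ: "?s UNIV z = ?s (-J) z + ?s J z" for z
    by (subst sum.union_disjoint[symmetric]) (auto intro: sum.cong)
  have fold: "(\<integral>\<^sup>+z. g z \<partial>?N UNIV) = (\<integral>\<^sup>+b. \<integral>\<^sup>+a. g (merge (-J) J (b, a)) \<partial>?N J \<partial>?N (-J))"
    if "g \<in> borel_measurable (?N UNIV)" for g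
    using normal_prod.product_nn_integral_fold[of "-J" J g] that by simp
  have mJ: "?s (-J) (merge (-J) J (b, a)) = ?s (-J) b" "?s J (merge (-J) J (b, a)) = ?s J a" for a b
    by (auto intro!: sum.cong)
  \<comment> \<open>Applied below to \<open>f\<close> itself, to functions of the projection alone
    and to functions of the residual alone; in the last two cases the other block integrates to its
    total mass 1.\<close>
  have gen: "(\<integral>\<^sup>+x. h (orth_proj S x) (x - orth_proj S x) \<partial>std_gauss)
      = (\<integral>\<^sup>+b. \<integral>\<^sup>+a. h (?s J a) (?s (-J) b) \<partial>?N J \<partial>?N (-J))"
    if [measurable]: "(\<lambda>(a, b). h a b) \<in> borel_measurable (borel \<Otimes>\<^sub>M borel)" for h :: "real ^ 'n \<Rightarrow> real ^ 'n \<Rightarrow> ennreal"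
  proof -
    have "(\<integral>\<^sup>+x. h (orth_proj S x) (x - orth_proj S x) \<partial>std_gauss)
       = (\<integral>\<^sup>+z. h (orth_proj S (?s UNIV z)) (?s UNIV z - orth_proj S (?s UNIV z)) \<partial>?N UNIV)"
      by (rule nn_integral_std_gauss_basis[OF u]) measurable
    also have "\<dots> = (\<integral>\<^sup>+b. \<integral>\<^sup>+a. h (orth_proj S (?s UNIV (merge (-J) J (b, a)))) (?s UNIV (merge (-J) J (b, a)) - orth_proj S (?s UNIV (merge (-J) J (b, a)))) \<partial>?N J \<partial>?N (-J))"
      by (rule fold) measurable
    also have "\<dots> = (\<integral>\<^sup>+b. \<integral>\<^sup>+a. h (?s J a) (?s (-J) b) \<partial>?N J \<partial>?N (-J))"
      unfolding PT unfolding UJ by (simp only: mJ add_diff_cancel_right')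
    finally show ?thesis .
  qed
  define F where "F c = (\<integral>\<^sup>+a. f (?s J a) c \<partial>?N J)" for c
  interpret J: sigma_finite_measure "?N J"
    by (intro prob_space_imp_sigma_finite prob_space_PiM std_normal.prob_space_axioms)
  have [measurable]: "F \<in> borel_measurable borel"
    unfolding F_def by measurable
  have inner: "(\<integral>\<^sup>+x. f (orth_proj S x) c \<partial>std_gauss) = F c" for c
    using gen[of "\<lambda>a b. f a c"] by (simp add: F_def prob)
  have "(\<integral>\<^sup>+y. \<integral>\<^sup>+x. f (orth_proj S x) (y - orth_proj S y) \<partial>std_gauss \<partial>std_gauss)
     = (\<integral>\<^sup>+y. F (y - orth_proj S y) \<partial>std_gauss)"
    by (simp add: inner)
  also have "\<dots> = (\<integral>\<^sup>+b. \<integral>\<^sup>+a. F (?s (-J) b) \<partial>?N J \<partial>?N (-J))"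
    by (rule gen[of "\<lambda>a b. F b"]) measurable
  also have "\<dots> = (\<integral>\<^sup>+b. F (?s (-J) b) \<partial>?N (-J))"
    by (simp add: prob)
  also have "\<dots> = (\<integral>\<^sup>+x. f (orth_proj S x) (x - orth_proj S x) \<partial>std_gauss)"
    unfolding F_def by (rule gen[symmetric]) measurable
  finally show ?thesis by simp
qed

text \<open>Completing the square: the exact value carries the further factor exp (- s c^2 / (1 + 2
  s)), which is at most 1. A shift of the mean can only lower the Laplace transform of the square,
  so a biased residual does no harm.\<close>

lemma nn_integral_std_normal_exp:
  assumes s: "s \<ge> 0"
  shows "(\<integral>\<^sup>+z. ennreal (exp (- s * (c + z)\<^sup>2)) \<partial>std_normal) \<le> ennreal (1 / sqrt (1 + 2 * s))"
proof -
  \<comment> \<open>Mean \<open>m\<close> and standard deviation \<open>v\<close> of the normal law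
    proportional to \<open>exp (- s * (c + z)\<^sup>2)\<close> times the standard density.\<close>
  define m where "m = - 2 * s * c / (1 + 2 * s)"
  define v where "v = 1 / sqrt (1 + 2 * s)"
  have v: "v > 0" "v\<^sup>2 = 1 / (1 + 2 * s)" using s by (auto simp: v_def power_divide)
  have e: "- s * (c + z)\<^sup>2 - z\<^sup>2 / 2 = - (z - m)\<^sup>2 / (2 * v\<^sup>2) - s * c\<^sup>2 / (1 + 2 * s)" for z
  proof -
    have "1 + 2 * s \<noteq> 0" using s by auto
    then show ?thesis unfolding v m_def
      by (simp add: divide_simps) (simp add: algebra_simps power2_eq_square)
  qed
  have d: "std_normal_density z * exp (- s * (c + z)\<^sup>2)
      = (v * exp (- s * c\<^sup>2 / (1 + 2 * s))) * normal_density m v z" for z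
  proof -
    have "std_normal_density z * exp (- s * (c + z)\<^sup>2) = 1 / sqrt (2 * pi) * exp (- s * (c + z)\<^sup>2 - z\<^sup>2 / 2)"
    proof -
      have "exp (- z\<^sup>2 / 2) * exp (- s * (c + z)\<^sup>2) = exp (- s * (c + z)\<^sup>2 - z\<^sup>2 / 2)"
        by (simp add: mult_exp_exp)
      then show ?thesis by (simp only: std_normal_density_def mult.assoc)
    qed
    also have "\<dots> = 1 / sqrt (2 * pi) * (exp (- (z - m)\<^sup>2 / (2 * v\<^sup>2)) * exp (- s * c\<^sup>2 / (1 + 2 * s)))"
      unfolding e by (simp add: mult_exp_exp)
    also have "\<dots> = (v * exp (- s * c\<^sup>2 / (1 + 2 * s))) * normal_density m v z"
      using v(1) by (simp add: normal_density_def real_sqrt_mult)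
    finally show ?thesis .
  qed
  have "(\<integral>\<^sup>+z. ennreal (exp (- s * (c + z)\<^sup>2)) \<partial>std_normal)
      = (\<integral>\<^sup>+z. ennreal (std_normal_density z * exp (- s * (c + z)\<^sup>2)) \<partial>lborel)"
    by (subst nn_integral_density) (auto simp: ennreal_mult')
  also have "\<dots> = ennreal (v * exp (- s * c\<^sup>2 / (1 + 2 * s))) * (\<integral>\<^sup>+z. ennreal (normal_density m v z) \<partial>lborel)"
    unfolding d using v by (subst nn_integral_cmult[symmetric]) (auto simp: ennreal_mult')
  also have "(\<integral>\<^sup>+z. ennreal (normal_density m v z) \<partial>lborel) = 1"
    using v(1) by (subst nn_integral_eq_integral) auto
  also have "v * exp (- s * c\<^sup>2 / (1 + 2 * s)) \<le> v"
    using s v(1) by (simp add: mult_left_le)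
  finally show ?thesis by (simp add: v_def ennreal_leI)
qed

text \<open>In an adapted basis the squared norm is a sum of \<open>resid_dim S\<close> squares of
  independent shifted normals, a noncentral chi-square variable, and its Laplace transform factors
  over the coordinates.\<close>

lemma nn_integral_std_gauss_exp_residual:
  fixes S :: "(real ^ 'n) set"
  assumes S: "subspace S" and s: "s \<ge> 0" and c: "orth_proj S c = 0"
  shows "(\<integral>\<^sup>+x. ennreal (exp (- s * (norm (c + (x - orth_proj S x)))\<^sup>2)) \<partial>std_gauss)
     \<le> ennreal ((1 / sqrt (1 + 2 * s)) ^ resid_dim S)"
proof -
  obtain u :: "'n \<Rightarrow> real ^ 'n" and J
    where u: "\<And>i j. u i \<bullet> u j = (if i = j then 1 else 0)" and cJ: "card J = dim S"
      and full: "\<And>x. x = (\<Sum>i\<in>UNIV. (x \<bullet> u i) *\<^sub>R u i)"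
      and P: "\<And>x. orth_proj S x = (\<Sum>i\<in>J. (x \<bullet> u i) *\<^sub>R u i)"
    by (rule adapted_orthonormal_basis[OF S], rule that, assumption+)
  note [measurable] = orth_proj_measurable[OF S]
  let ?N = "\<Pi>\<^sub>M i\<in>(UNIV::'n set). std_normal"
  let ?s = "\<lambda>I z. \<Sum>i\<in>I. z i *\<^sub>R u i"
  have PT: "orth_proj S (?s UNIV z) = ?s J z" for z
    unfolding P by (simp add: inner_sum_left u if_distrib cong: if_cong)
  have UJ: "?s UNIV z = ?s (-J) z + ?s J z" for z
    by (subst sum.union_disjoint[symmetric]) (auto intro: sum.cong)
  \<comment> \<open>The condition \<open>orth_proj S c = 0\<close> removes the coordinates of
    \<open>c\<close> in \<open>J\<close>.\<close>
  have cU: "c = ?s (-J) (\<lambda>i. c \<bullet> u i)"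
    using full[of c] c UJ[of "\<lambda>i. c \<bullet> u i"] by (simp add: P)
  have n: "(norm (c + (?s UNIV z - orth_proj S (?s UNIV z))))\<^sup>2 = (\<Sum>i\<in>-J. (c \<bullet> u i + z i)\<^sup>2)" for z
  proof -
    have "c + (?s UNIV z - orth_proj S (?s UNIV z)) = c + ?s (-J) z"
      unfolding PT unfolding UJ[of z] by simp
    also have "\<dots> = ?s (-J) (\<lambda>i. c \<bullet> u i) + ?s (-J) z"
      by (rule arg_cong[OF cU, where f="\<lambda>t. t + ?s (-J) z"])
    also have "\<dots> = (\<Sum>i\<in>-J. (c \<bullet> u i + z i) *\<^sub>R u i)"
      by (simp add: sum.distrib scaleR_add_left)
    finally show ?thesis
      by (simp only: power2_norm_eq_inner inner_sum_left inner_sum_right)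
         (simp add: u if_distrib power2_eq_square cong: if_cong)
  qed
  \<comment> \<open>Coordinates in \<open>J\<close> contribute a factor 1, so that the product
    extends over the whole index type of the product measure.\<close>
  have ex: "ennreal (exp (- s * (\<Sum>i\<in>-J. a i))) = (\<Prod>i\<in>UNIV. if i \<in> J then 1 else ennreal (exp (- s * a i)))" for a
  proof -
    have "exp (- s * (\<Sum>i\<in>-J. a i)) = (\<Prod>i\<in>-J. exp (- s * a i))"
      by (simp only: sum_distrib_left exp_sum[OF finite])
    also have "ennreal \<dots> = (\<Prod>i\<in>-J. ennreal (exp (- s * a i)))"
      by (rule prod_ennreal[symmetric]) simp
    also have "\<dots> = (\<Prod>i\<in>UNIV. if i \<in> J then 1 else ennreal (exp (- s * a i)))"
      by (rule prod.mono_neutral_cong_left) auto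
    finally show ?thesis .
  qed
  have "(\<integral>\<^sup>+x. ennreal (exp (- s * (norm (c + (x - orth_proj S x)))\<^sup>2)) \<partial>std_gauss)
      = (\<integral>\<^sup>+z. ennreal (exp (- s * (norm (c + (?s UNIV z - orth_proj S (?s UNIV z))))\<^sup>2)) \<partial>?N)"
    by (rule nn_integral_std_gauss_basis[OF u]) measurable
  also have "\<dots> = (\<integral>\<^sup>+z. (\<Prod>i\<in>UNIV. (if i \<in> J then 1 else ennreal (exp (- s * (c \<bullet> u i + z i)\<^sup>2)))) \<partial>?N)"
    unfolding n ex ..
  also have "\<dots> = (\<Prod>i\<in>UNIV. \<integral>\<^sup>+z. (if i \<in> J then 1 else ennreal (exp (- s * (c \<bullet> u i + z)\<^sup>2))) \<partial>std_normal)"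
    by (rule normal_prod.product_nn_integral_prod[where f="\<lambda>i z. if i \<in> J then 1 else ennreal (exp (- s * (c \<bullet> u i + z)\<^sup>2))"]) auto
  also have "\<dots> \<le> (\<Prod>i\<in>UNIV. if i \<in> J then 1 else ennreal (1 / sqrt (1 + 2 * s)))"
    using nn_integral_std_normal_exp[OF s] std_normal.emeasure_space_1
    by (intro prod_mono_ennreal) auto
  also have "\<dots> = ennreal ((1 / sqrt (1 + 2 * s)) ^ card (- J))"
    using s by (simp add: prod.If_cases ennreal_power Compl_eq_Diff_UNIV)
  also have "card (- J) = resid_dim S"
    by (simp add: Compl_eq_Diff_UNIV card_Diff_subset resid_dim_def cJ)
  finally show ?thesis .
qed

section \<open>Stein's identity\<close>

lemma integrable_std_normal_quadratic:
  fixes g :: "real \<Rightarrow> real"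
  assumes [measurable]: "g \<in> borel_measurable borel" and g: "\<And>z. \<bar>g z\<bar> \<le> A + B * z\<^sup>2"
  shows "integrable std_normal g"
proof -
  have k: "integrable std_normal (\<lambda>z. z ^ k)" for k
    using integrable_std_normal_moment[of k] by (subst integrable_density) auto
  have "integrable std_normal (\<lambda>z. A + B * z\<^sup>2)"
    using k[of 2] by (intro Bochner_Integration.integrable_add integrable_mult_right std_normal.integrable_const) 
  then show ?thesis
    by (rule Bochner_Integration.integrable_bound) (use g in \<open>auto intro!: AE_I2 intro: order_trans[OF _ abs_ge_self]\<close>)
qed

text \<open>The derivative of \<open>f\<close> times the standard density is the difference of the
  two integrands, and the boundary terms vanish because \<open>f\<close> grows at most linearly. The
  bound on \<open>f'\<close> is quadratic because differentiating Gibbs weights produces a quadratic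
  term.\<close>

lemma stein_std_normal:
  fixes f f' :: "real \<Rightarrow> real"
  assumes deriv: "\<And>z. (f has_real_derivative f' z) (at z)"
    and cont: "continuous_on UNIV f'"
    and A: "A \<ge> 0" and B: "B \<ge> 0"
    and f: "\<And>z. \<bar>f z\<bar> \<le> A + B * \<bar>z\<bar>" and f': "\<And>z. \<bar>f' z\<bar> \<le> A + B * z\<^sup>2"
  shows "(\<integral>z. z * f z \<partial>std_normal) = (\<integral>z. f' z \<partial>std_normal)"
proof -
  let ?\<phi> = std_normal_density
  have contf: "continuous_on UNIV f"
    using deriv by (meson DERIV_isCont continuous_at_imp_continuous_on)
  note [measurable] = borel_measurable_continuous_onI[OF cont] borel_measurable_continuous_onI[OF contf]
  have zf: "\<bar>z * f z\<bar> \<le> (A + B) + (A + B) * z\<^sup>2" for z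
  proof -
    have "\<bar>z * f z\<bar> \<le> \<bar>z\<bar> * (A + B * \<bar>z\<bar>)"
      unfolding abs_mult by (intro mult_left_mono f) simp
    also have "\<dots> = A * \<bar>z\<bar> + B * z\<^sup>2"
      by (simp add: algebra_simps power2_eq_square)
    also have "\<dots> \<le> A * (1 + z\<^sup>2) + B * (1 + z\<^sup>2)"
    proof (intro add_mono mult_left_mono A B)
      show "\<bar>z\<bar> \<le> 1 + z\<^sup>2"
        using sum_squares_bound[of 1 "\<bar>z\<bar>"] abs_ge_zero[of z] by (simp del: abs_ge_zero)
    qed simp
    finally show ?thesis by (simp add: algebra_simps)
  qed
  have int: "integrable std_normal f'" "integrable std_normal (\<lambda>z. z * f z)"
    by (rule integrable_std_normal_quadratic[of _ A B], measurable, rule f')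
       (rule integrable_std_normal_quadratic[of _ "A + B" "A + B"], measurable, rule zf)
  have int': "integrable lborel (\<lambda>z. ?\<phi> z * f' z)" "integrable lborel (\<lambda>z. ?\<phi> z * (z * f z))"
    using int by (simp_all add: integrable_density)
  have d\<phi>: "(?\<phi> has_real_derivative - z * ?\<phi> z) (at z)" for z
  proof -
    have "((\<lambda>z. exp (- z\<^sup>2 / 2)) has_real_derivative - z * exp (- z\<^sup>2 / 2)) (at z)"
      by (auto intro!: derivative_eq_intros)
    from DERIV_cmult[OF this, of "1 / sqrt (2 * pi)"] show ?thesis
      by (simp add: std_normal_density_def[abs_def])
  qed
  have lim: "((\<lambda>z. f z * ?\<phi> z) \<longlongrightarrow> 0) F" if F: "F = at_top \<or> F = at_bot" for F
  proof (rule Lim_null_comparison)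
    show "\<forall>\<^sub>F z in F. norm (f z * ?\<phi> z) \<le> A * ?\<phi> z + B * (\<bar>z\<bar> * ?\<phi> z)"
      using f by (intro always_eventually allI)
        (auto simp: abs_mult distrib_right[symmetric] mult.assoc[symmetric] intro!: mult_right_mono)
    have "(?\<phi> \<longlongrightarrow> 0) F" "((\<lambda>z. \<bar>z\<bar> * ?\<phi> z) \<longlongrightarrow> 0) F"
      using F unfolding std_normal_density_def by (elim disjE; hypsubst; real_asymp)+
    then have "((\<lambda>z. A * ?\<phi> z + B * (\<bar>z\<bar> * ?\<phi> z)) \<longlongrightarrow> A * 0 + B * 0) F"
      by (intro tendsto_intros)
    then show "((\<lambda>z. A * ?\<phi> z + B * (\<bar>z\<bar> * ?\<phi> z)) \<longlongrightarrow> 0) F" by simp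
  qed
  have "(LBINT z=-\<infinity>..\<infinity>. ?\<phi> z * f' z - ?\<phi> z * (z * f z)) = 0 - 0"
  proof (rule interval_integral_FTC_integrable[where F="\<lambda>z. f z * ?\<phi> z"])
    show "((\<lambda>z. f z * ?\<phi> z) has_vector_derivative ?\<phi> z * f' z - ?\<phi> z * (z * f z)) (at z)" for z
      unfolding has_real_derivative_iff_has_vector_derivative[symmetric]
      by (rule DERIV_cong[OF DERIV_mult[OF deriv d\<phi>]]) (simp add: algebra_simps)
    show "isCont (\<lambda>z. ?\<phi> z * f' z - ?\<phi> z * (z * f z)) z" for z
      using cont contf unfolding std_normal_density_def
      by (intro continuous_intros) (auto simp: continuous_on_eq_continuous_at)
    show "set_integrable lborel (einterval (-\<infinity>) \<infinity>) (\<lambda>z. ?\<phi> z * f' z - ?\<phi> z * (z * f z))"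
      using int' by (simp add: set_integrable_def einterval_eq)
    show "(((\<lambda>z. f z * ?\<phi> z) \<circ> real_of_ereal) \<longlongrightarrow> 0) (at_right (-\<infinity>))"
      using lim[of at_bot] by (simp add: ereal_tendsto_simps)
    show "(((\<lambda>z. f z * ?\<phi> z) \<circ> real_of_ereal) \<longlongrightarrow> 0) (at_left \<infinity>)"
      using lim[of at_top] by (simp add: ereal_tendsto_simps)
  qed simp
  then have "(\<integral>z. ?\<phi> z * f' z \<partial>lborel) = (\<integral>z. ?\<phi> z * (z * f z) \<partial>lborel)"
    using int' by (simp add: interval_lebesgue_integral_def einterval_eq set_lebesgue_integral_def)
  then show ?thesis
    by (simp add: integral_density)
qed

lemma distr_std_gauss_component:
  "distr (std_gauss :: (real ^ 'n) measure) borel (\<lambda>x. x $ i) = std_normal"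
proof -
  let ?N = "\<Pi>\<^sub>M i\<in>(UNIV :: 'n set). std_normal"
  have "distr std_gauss borel (\<lambda>x::real^'n. x $ i) = distr ?N borel (\<lambda>z. z i)"
    unfolding std_gauss_def by (subst distr_distr) (auto simp: comp_def)
  also have "\<dots> = distr ?N std_normal (\<lambda>z. z i)"
    by (rule distr_cong) auto
  also have "\<dots> = std_normal"
    using distr_PiM_component[of UNIV "\<lambda>_. std_normal" i] std_normal.prob_space_axioms by simp
  finally show ?thesis .
qed

lemma integrable_std_gauss_quadratic:
  fixes g :: "real ^ 'n \<Rightarrow> real"
  assumes [measurable]: "g \<in> borel_measurable borel" and g: "\<And>x. \<bar>g x\<bar> \<le> A + B * (norm x)\<^sup>2"
  shows "integrable std_gauss g"
proof -
  interpret prob_space "std_gauss :: (real ^ 'n) measure" by (rule prob_space_std_gauss)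
  have "integrable std_normal (\<lambda>z. z\<^sup>2)"
    by (rule integrable_std_normal_quadratic[of _ 0 1]) auto
  then have k: "integrable (std_gauss :: (real ^ 'n) measure) (\<lambda>x. (x $ i)\<^sup>2)" for i :: 'n
    unfolding distr_std_gauss_component[of i, symmetric] by (subst (asm) integrable_distr_eq) auto
  have n: "(norm x)\<^sup>2 = (\<Sum>i\<in>UNIV. (x $ i)\<^sup>2)" for x :: "real ^ 'n"
    unfolding power2_norm_eq_inner inner_vec_def by (simp add: power2_eq_square)
  have "integrable (std_gauss :: (real ^ 'n) measure) (\<lambda>x. A + B * (norm x)\<^sup>2)"
    unfolding n using k
    by (intro Bochner_Integration.integrable_add integrable_mult_right integrable_const Bochner_Integration.integrable_sum)
  then show ?thesis
    by (rule Bochner_Integration.integrable_bound) (use g in \<open>auto intro!: AE_I2 intro: order_trans[OF _ abs_ge_self]\<close>)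
qed

text \<open>Fubini with the coordinate \<open>i\<close> innermost: on each line parallel to that
  axis the one-dimensional identity applies.\<close>

lemma stein_std_gauss_component:
  fixes h D :: "real ^ 'n \<Rightarrow> real"
  assumes deriv: "\<And>x. ((\<lambda>t. h (x + t *\<^sub>R axis i 1)) has_real_derivative D x) (at 0)"
    and conth: "continuous_on UNIV h" and cont: "continuous_on UNIV D"
    and A: "A \<ge> 0" and B: "B \<ge> 0"
    and h: "\<And>x. \<bar>h x\<bar> \<le> A + B * norm x" and D: "\<And>x. \<bar>D x\<bar> \<le> A + B * (norm x)\<^sup>2"
  shows "integrable std_gauss (\<lambda>x. x $ i * h x)" "integrable std_gauss D"
    and "(\<integral>x. x $ i * h x \<partial>std_gauss) = (\<integral>x. D x \<partial>std_gauss)"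
proof -
  note [measurable] = borel_measurable_continuous_onI[OF cont] borel_measurable_continuous_onI[OF conth]
  let ?N = "\<lambda>I::'n set. \<Pi>\<^sub>M i\<in>I. std_normal"
  have zh: "\<bar>x $ i * h x\<bar> \<le> (A + B) + (A + B) * (norm x)\<^sup>2" for x
  proof -
    have "\<bar>x $ i * h x\<bar> \<le> norm x * (A + B * norm x)"
      unfolding abs_mult by (intro mult_mono h component_le_norm_cart) auto
    also have "\<dots> = A * norm x + B * (norm x)\<^sup>2"
      by (simp add: algebra_simps power2_eq_square)
    also have "\<dots> \<le> A * (1 + (norm x)\<^sup>2) + B * (1 + (norm x)\<^sup>2)"
    proof (intro add_mono mult_left_mono A B)
      show "norm x \<le> 1 + (norm x)\<^sup>2"
        using sum_squares_bound[of 1 "norm x"] norm_ge_zero[of x] by (simp del: norm_ge_zero)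
    qed simp
    finally show ?thesis by (simp add: algebra_simps)
  qed
  show i1: "integrable std_gauss (\<lambda>x. x $ i * h x)"
    by (rule integrable_std_gauss_quadratic[OF _ zh]) measurable
  show i2: "integrable std_gauss D"
    by (rule integrable_std_gauss_quadratic[OF _ D]) measurable
  have fub: "(\<integral>x. g x \<partial>std_gauss) = (\<integral>x. \<integral>y. g (vec_lambda (x(i := y))) \<partial>std_normal \<partial>?N (UNIV - {i}))"
    if "integrable std_gauss g" for g :: "real ^ 'n \<Rightarrow> real"
  proof -
    have [measurable]: "g \<in> borel_measurable borel"
      using borel_measurable_integrable[OF that] by simp
    have I: "insert i (UNIV - {i}) = UNIV" by auto
    have "integrable (?N UNIV) (\<lambda>z. g (vec_lambda z))"
      using that unfolding std_gauss_def by (subst (asm) integrable_distr_eq) auto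
    then have "(\<integral>z. g (vec_lambda z) \<partial>?N UNIV) = (\<integral>x. \<integral>y. g (vec_lambda (x(i := y))) \<partial>std_normal \<partial>?N (UNIV - {i}))"
      using normal_prod.product_integral_insert[of "UNIV - {i}" i "\<lambda>z. g (vec_lambda z)"] by (simp add: I)
    moreover have "(\<integral>x. g x \<partial>std_gauss) = (\<integral>z. g (vec_lambda z) \<partial>?N UNIV)"
      unfolding std_gauss_def by (rule integral_distr) measurable
    ultimately show ?thesis by simp
  qed
  have "(\<integral>y. vec_lambda (x(i := y)) $ i * h (vec_lambda (x(i := y))) \<partial>std_normal)
      = (\<integral>y. D (vec_lambda (x(i := y))) \<partial>std_normal)" for x
  proof -
    define v where "v = vec_lambda (x(i := 0))"
    have v: "vec_lambda (x(i := y)) = v + y *\<^sub>R axis i 1" for y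
      by (simp add: v_def vec_eq_iff axis_def)
    have nv: "norm (v + y *\<^sub>R axis i 1) \<le> norm v + \<bar>y\<bar>" for y
      using norm_triangle_ineq[of v "y *\<^sub>R axis i 1"] by simp
    have nv2: "(norm (v + y *\<^sub>R axis i 1))\<^sup>2 \<le> 2 * (norm v)\<^sup>2 + 2 * y\<^sup>2" for y
    proof -
      have "(norm (v + y *\<^sub>R axis i 1))\<^sup>2 \<le> (norm v + \<bar>y\<bar>)\<^sup>2"
        by (intro power_mono nv) simp
      also have "\<dots> \<le> 2 * (norm v)\<^sup>2 + 2 * y\<^sup>2"
        using sum_squares_bound[of "norm v" "\<bar>y\<bar>"] by (simp add: power2_sum)
      finally show ?thesis .
    qed
    let ?A = "A + B * norm v + B * (2 * (norm v)\<^sup>2)"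
    have "(\<integral>y. y * h (v + y *\<^sub>R axis i 1) \<partial>std_normal) = (\<integral>y. D (v + y *\<^sub>R axis i 1) \<partial>std_normal)"
    proof (rule stein_std_normal)
      show "((\<lambda>y. h (v + y *\<^sub>R axis i 1)) has_real_derivative D (v + z *\<^sub>R axis i 1)) (at z)" for z
      proof -
        have "((\<lambda>t. h (v + z *\<^sub>R axis i 1 + t *\<^sub>R axis i 1)) has_real_derivative D (v + z *\<^sub>R axis i 1)) (at (z - z))"
          using deriv[of "v + z *\<^sub>R axis i 1"] by simp
        then have "((\<lambda>y. h (v + z *\<^sub>R axis i 1 + (y - z) *\<^sub>R axis i 1)) has_real_derivative D (v + z *\<^sub>R axis i 1) * 1) (at z)"
          by (rule DERIV_chain2[where g="\<lambda>y. y - z"]) (auto intro!: derivative_eq_intros)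
        then show ?thesis by (simp add: algebra_simps)
      qed
      show "continuous_on UNIV (\<lambda>y. D (v + y *\<^sub>R axis i 1))"
        by (intro continuous_on_compose2[OF cont] continuous_intros) auto
      show "\<bar>h (v + z *\<^sub>R axis i 1)\<bar> \<le> ?A + 2 * B * \<bar>z\<bar>" for z
      proof -
        have "\<bar>h (v + z *\<^sub>R axis i 1)\<bar> \<le> A + B * (norm v + \<bar>z\<bar>)"
          using h[of "v + z *\<^sub>R axis i 1"] mult_left_mono[OF nv B, of z] by linarith
        also have "\<dots> \<le> ?A + 2 * B * \<bar>z\<bar>"
          using A B by (simp add: algebra_simps)
        finally show ?thesis .
      qed
      show "\<bar>D (v + z *\<^sub>R axis i 1)\<bar> \<le> ?A + 2 * B * z\<^sup>2" for z
      proof -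
        have "\<bar>D (v + z *\<^sub>R axis i 1)\<bar> \<le> A + B * (2 * (norm v)\<^sup>2 + 2 * z\<^sup>2)"
          using D[of "v + z *\<^sub>R axis i 1"] mult_left_mono[OF nv2 B, of z] by linarith
        also have "\<dots> \<le> ?A + 2 * B * z\<^sup>2"
          using A B by (simp add: algebra_simps)
        finally show ?thesis .
      qed
    qed (use A B in auto)
    then show ?thesis by (simp add: v) (simp add: v_def)
  qed
  then show "(\<integral>x. x $ i * h x \<partial>std_gauss) = (\<integral>x. D x \<partial>std_gauss)"
    unfolding fub[OF i1] fub[OF i2] by simp
qed

text \<open>The coordinate identities are summed. Each \<open>D i\<close> is a diagonal entry of the
  Jacobian of \<open>h\<close>, so their sum is its divergence.\<close>

lemma stein_std_gauss:
  fixes h :: "real ^ 'n \<Rightarrow> real ^ 'n" and D :: "'n \<Rightarrow> real ^ 'n \<Rightarrow> real"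
  assumes deriv: "\<And>i x. ((\<lambda>t. h (x + t *\<^sub>R axis i 1) $ i) has_real_derivative D i x) (at 0)"
    and conth: "continuous_on UNIV h" and cont: "\<And>i. continuous_on UNIV (D i)"
    and A: "A \<ge> 0" and B: "B \<ge> 0"
    and h: "\<And>x. norm (h x) \<le> A + B * norm x" and D: "\<And>i x. \<bar>D i x\<bar> \<le> A + B * (norm x)\<^sup>2"
  shows "integrable std_gauss (\<lambda>x. x \<bullet> h x)" "integrable std_gauss (\<lambda>x. \<Sum>i\<in>UNIV. D i x)"
    and "(\<integral>x. x \<bullet> h x \<partial>std_gauss) = (\<integral>x. (\<Sum>i\<in>UNIV. D i x) \<partial>std_gauss)"
proof -
  have "continuous_on UNIV (\<lambda>x. h x $ i)" for i
    using conth by (intro continuous_intros)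
  moreover have "\<bar>h x $ i\<bar> \<le> A + B * norm x" for x i
    using component_le_norm_cart[of "h x" i] h[of x] by linarith
  ultimately have *: "integrable std_gauss (\<lambda>x. x $ i * h x $ i)" "integrable std_gauss (D i)"
      "(\<integral>x. x $ i * h x $ i \<partial>std_gauss) = (\<integral>x. D i x \<partial>std_gauss)" for i
    using stein_std_gauss_component[of "\<lambda>x. h x $ i" i "D i" A B] deriv cont A B D by auto
  have e: "x \<bullet> h x = (\<Sum>i\<in>UNIV. x $ i * h x $ i)" for x
    by (simp add: inner_vec_def)
  show "integrable std_gauss (\<lambda>x. x \<bullet> h x)" "integrable std_gauss (\<lambda>x. \<Sum>i\<in>UNIV. D i x)"
    unfolding e using * by auto
  show "(\<integral>x. x \<bullet> h x \<partial>std_gauss) = (\<integral>x. (\<Sum>i\<in>UNIV. D i x) \<partial>std_gauss)"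
    unfolding e using * by simp
qed

text \<open>Stein's identity for a constant field, whose divergence is zero.\<close>

lemma std_gauss_inner:
  fixes c :: "real ^ 'n"
  shows "integrable std_gauss (\<lambda>x. x \<bullet> c)" "(\<integral>x. x \<bullet> c \<partial>std_gauss) = 0"
  using stein_std_gauss[of "\<lambda>_. c" "\<lambda>_ _. 0" "norm c" 0] by auto

text \<open>The centred part is Stein's identity for the field \<open>orth_proj S\<close>, whose
  divergence is the trace \<open>dim S\<close>; the cross term has mean zero.\<close>

lemma std_gauss_orth_proj:
  fixes S :: "(real ^ 'n) set"
  assumes S: "subspace S"
  shows "integrable std_gauss (\<lambda>x. (norm (orth_proj S (\<mu> + \<sigma> *\<^sub>R x)))\<^sup>2)"
    and "(\<integral>x. (norm (orth_proj S (\<mu> + \<sigma> *\<^sub>R x)))\<^sup>2 \<partial>std_gauss) = (norm (orth_proj S \<mu>))\<^sup>2 + \<sigma>\<^sup>2 * dim S"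
proof -
  interpret prob_space "std_gauss :: (real ^ 'n) measure" by (rule prob_space_std_gauss)
  have bl: "bounded_linear (orth_proj S)"
    using linear_orth_proj[OF S] by (simp add: linear_conv_bounded_linear)
  have le: "\<bar>orth_proj S (axis i 1) $ i\<bar> \<le> 1" for i
    using component_le_norm_cart[of "orth_proj S (axis i 1)" i] norm_orth_proj_le[OF S, of "axis i 1"]
    by simp
  have d: "((\<lambda>t. orth_proj S (x + t *\<^sub>R axis i 1) $ i) has_real_derivative orth_proj S (axis i 1) $ i) (at 0)" for i x
    unfolding orth_proj_add[OF S] orth_proj_scaleR[OF S]
    by (auto intro!: derivative_eq_intros)
  have b: "\<bar>orth_proj S (axis i 1) $ i\<bar> \<le> 1 + 1 * (norm x)\<^sup>2" for i and x :: "real ^ 'n"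
    using le[of i] zero_le_power2[of "norm x"] by linarith
  have b': "norm (orth_proj S x) \<le> 1 + 1 * norm x" for x
    using norm_orth_proj_le[OF S, of x] by simp
  note st = stein_std_gauss[where h="orth_proj S" and D="\<lambda>i _. orth_proj S (axis i 1) $ i",
      OF d bounded_linear.continuous_on[OF bl continuous_on_id] continuous_on_const
        zero_le_one zero_le_one b' b]
  have tr: "(\<integral>x. x \<bullet> orth_proj S x \<partial>std_gauss) = dim S"
    unfolding st(3) trace_orth_proj[OF S] using prob_space by simp
  have h: "\<mu> \<bullet> orth_proj S x = x \<bullet> orth_proj S \<mu>" for x
    by (metis S inner_commute orth_proj_selfadjoint)
  have e: "(norm (orth_proj S (\<mu> + \<sigma> *\<^sub>R x)))\<^sup>2
      = (norm (orth_proj S \<mu>))\<^sup>2 + (2 * \<sigma> * (x \<bullet> orth_proj S \<mu>) + \<sigma>\<^sup>2 * (x \<bullet> orth_proj S x))" for x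
    unfolding orth_proj_inner_self[OF S, symmetric]
    using h[of x]
    by (simp add: orth_proj_add[OF S] orth_proj_scaleR[OF S] inner_add_left inner_add_right
        power2_eq_square algebra_simps)
  note i = std_gauss_inner[of "orth_proj S \<mu>"]
  show "integrable std_gauss (\<lambda>x. (norm (orth_proj S (\<mu> + \<sigma> *\<^sub>R x)))\<^sup>2)"
    unfolding e using i(1) st(1)
    by (intro Bochner_Integration.integrable_add integrable_mult_right integrable_const)
  show "(\<integral>x. (norm (orth_proj S (\<mu> + \<sigma> *\<^sub>R x)))\<^sup>2 \<partial>std_gauss) = (norm (orth_proj S \<mu>))\<^sup>2 + \<sigma>\<^sup>2 * dim S"
    unfolding e using i st(1) tr prob_space by simp
qed

section \<open>Gibbs mixtures of projections\<close>

text \<open>Termwise form of the nonnegativity of relative entropy: x log x \<ge> x - 1 at x = exp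
  l.\<close>

lemma exp_mult_self_ge: "exp l * l \<ge> exp l - (1::real)"
proof -
  have "1 - l \<le> exp (- l)" using exp_ge_add_one_self[of "- l"] by simp
  then have "exp l * (1 - l) \<le> exp l * exp (- l)" by (intro mult_left_mono) auto
  then show ?thesis by (simp add: exp_minus algebra_simps)
qed

text \<open>The inverse temperature stays out of the locale and is an argument of every notion: it
  is a fixed number while Stein's identity is applied and becomes the random \<beta> / s
  afterwards.\<close>

locale gibbs_mixture =
  fixes M :: "'m set" and S :: "'m \<Rightarrow> (real ^ 'n) set" and \<pi> L :: "'m \<Rightarrow> real"
  assumes fin: "finite M" and sub: "\<And>m. m \<in> M \<Longrightarrow> subspace (S m)"
    and pi_nonneg: "\<And>m. m \<in> M \<Longrightarrow> \<pi> m \<ge> 0" and pi_sum: "(\<Sum>m\<in>M. \<pi> m) = 1"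
begin

definition raw :: "real \<Rightarrow> real ^ 'n \<Rightarrow> 'm \<Rightarrow> real" where
  "raw lam y m = \<pi> m * exp (lam * (norm (orth_proj (S m) y))\<^sup>2 - L m)"

definition Z :: "real \<Rightarrow> real ^ 'n \<Rightarrow> real" where
  "Z lam y = (\<Sum>m\<in>M. raw lam y m)"

definition avg :: "real \<Rightarrow> real ^ 'n \<Rightarrow> ('m \<Rightarrow> real) \<Rightarrow> real" where
  "avg lam y g = (\<Sum>m\<in>M. raw lam y m * g m) / Z lam y"

definition est :: "real \<Rightarrow> real ^ 'n \<Rightarrow> real ^ 'n" where
  "est lam y = (\<Sum>m\<in>M. (raw lam y m / Z lam y) *\<^sub>R orth_proj (S m) y)"

text \<open>The derivative of coordinate \<open>i\<close> of \<open>est lam\<close> in direction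
  \<open>i\<close>. Since the log-weight of \<open>m\<close> has derivative
  \<open>2 * lam * orth_proj (S m) y $ i\<close>, it is the average derivative of the projections
  plus \<open>2 * lam\<close> times the Gibbs variance of that coordinate.\<close>

definition partial :: "real \<Rightarrow> 'n \<Rightarrow> real ^ 'n \<Rightarrow> real" where
  "partial lam i y = avg lam y (\<lambda>m. 2 * lam * (orth_proj (S m) y $ i)\<^sup>2 + orth_proj (S m) (axis i 1) $ i)
     - 2 * lam * (est lam y $ i)\<^sup>2"

section \<open>Gibbs averages: positivity, linearity and bounds\<close>

lemma sum_pi_exp_pos: "(\<Sum>m\<in>M. \<pi> m * exp (g m)) > 0"
proof -
  obtain m where "m \<in> M" "\<pi> m \<noteq> 0"
    using pi_sum by (metis sum.neutral zero_neq_one)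
  then show ?thesis
    using pi_nonneg fin by (intro sum_pos2[of M m]) (auto simp: less_le)
qed

lemma Z_pos: "Z lam y > 0"
  unfolding Z_def raw_def by (rule sum_pi_exp_pos)

lemma raw_nonneg: "m \<in> M \<Longrightarrow> raw lam y m \<ge> 0"
  by (simp add: raw_def pi_nonneg)

lemma avg_mono: "(\<And>m. m \<in> M \<Longrightarrow> f m \<le> g m) \<Longrightarrow> avg lam y f \<le> avg lam y g"
  unfolding avg_def using Z_pos[of lam y]
  by (intro divide_right_mono sum_mono mult_left_mono raw_nonneg) auto

lemma avg_const: "avg lam y (\<lambda>_. c) = c"
  using Z_pos[of lam y] by (simp add: avg_def Z_def sum_distrib_right[symmetric])

lemma avg_nonneg: "(\<And>m. m \<in> M \<Longrightarrow> 0 \<le> f m) \<Longrightarrow> 0 \<le> avg lam y f"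
  using avg_mono[of "\<lambda>_. 0" f lam y] by (simp add: avg_const)

lemma avg_add: "avg lam y (\<lambda>m. f m + g m) = avg lam y f + avg lam y g"
  by (simp add: avg_def distrib_left sum.distrib add_divide_distrib)

lemma avg_diff: "avg lam y (\<lambda>m. f m - g m) = avg lam y f - avg lam y g"
  by (simp add: avg_def right_diff_distrib sum_subtractf diff_divide_distrib)

lemma avg_cmult: "avg lam y (\<lambda>m. c * f m) = c * avg lam y f"
  by (simp add: avg_def sum_distrib_left mult_ac)

lemma avg_sum: "avg lam y (\<lambda>m. \<Sum>i\<in>I. f i m) = (\<Sum>i\<in>I. avg lam y (f i))"
  unfolding avg_def sum_distrib_left
  by (subst sum.swap) (simp add: sum_divide_distrib)

lemma est_component: "est lam y $ i = avg lam y (\<lambda>m. orth_proj (S m) y $ i)"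
  by (simp add: est_def avg_def sum_divide_distrib)

lemma inner_est: "x \<bullet> est lam y = avg lam y (\<lambda>m. x \<bullet> orth_proj (S m) y)"
  by (simp add: est_def avg_def inner_sum_right sum_divide_distrib)

text \<open>Each projection is a contraction; pairing \<open>est lam y\<close> with itself and
  averaging the Cauchy-Schwarz bound passes this on to the mixture, whatever the
  temperature.\<close>

lemma norm_est_le: "norm (est lam y) \<le> norm y"
proof -
  have "est lam y \<bullet> est lam y = avg lam y (\<lambda>m. est lam y \<bullet> orth_proj (S m) y)"
    by (rule inner_est)
  also have "\<dots> \<le> avg lam y (\<lambda>_. norm (est lam y) * norm y)"
    by (intro avg_mono order_trans[OF norm_cauchy_schwarz] mult_left_mono norm_orth_proj_le sub) auto
  finally have "(norm (est lam y))\<^sup>2 \<le> norm (est lam y) * norm y"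
    by (simp add: avg_const power2_norm_eq_inner)
  then show ?thesis
    by (cases "norm (est lam y) = 0") (auto simp: power2_eq_square)
qed

lemma continuous_on_orth_proj: "m \<in> M \<Longrightarrow> continuous_on A (orth_proj (S m))"
  using linear_orth_proj[OF sub, of m]
  by (intro linear_continuous_on) (simp add: linear_conv_bounded_linear)

lemma continuous_on_raw: "m \<in> M \<Longrightarrow> continuous_on A (\<lambda>y. raw lam y m)"
  unfolding raw_def by (intro continuous_intros continuous_on_orth_proj)

lemma continuous_on_avg:
  "(\<And>m. m \<in> M \<Longrightarrow> continuous_on A (f m)) \<Longrightarrow> continuous_on A (\<lambda>y. avg lam y (\<lambda>m. f m y))"
  unfolding avg_def
  using Z_pos by (intro continuous_intros continuous_on_raw) (auto simp: Z_def less_le intro!: continuous_intros continuous_on_raw)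

lemma continuous_on_est: "continuous_on A (est lam)"
proof -
  have "continuous_on A (\<lambda>y. \<chi> i. est lam y $ i)"
    unfolding est_component
    by (intro continuous_intros continuous_on_avg continuous_on_orth_proj)
  then show ?thesis by simp
qed

lemma continuous_on_partial: "continuous_on A (partial lam i)"
  unfolding partial_def
  by (intro continuous_intros continuous_on_avg continuous_on_orth_proj continuous_on_est)

text \<open>The coordinatewise variances add up to the total spread of the projections around
  \<open>est lam y\<close>, and the derivatives of the projections add up to traces, which are
  dimensions.\<close>

lemma sum_partial:
  "(\<Sum>i\<in>UNIV. partial lam i y)
     = 2 * lam * (avg lam y (\<lambda>m. (norm (orth_proj (S m) y))\<^sup>2) - (norm (est lam y))\<^sup>2) + avg lam y (\<lambda>m. dim (S m))"
proof -
  have n: "(norm x)\<^sup>2 = (\<Sum>i\<in>UNIV. (x $ i)\<^sup>2)" for x :: "real ^ 'n"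
    unfolding power2_norm_eq_inner inner_vec_def by (simp add: power2_eq_square)
  have "(\<Sum>i\<in>UNIV. partial lam i y) = avg lam y (\<lambda>m. \<Sum>i\<in>UNIV. 2 * lam * (orth_proj (S m) y $ i)\<^sup>2 + orth_proj (S m) (axis i 1) $ i)
     - 2 * lam * (norm (est lam y))\<^sup>2"
    unfolding partial_def avg_sum n by (simp add: sum_subtractf sum_distrib_left)
  also have "avg lam y (\<lambda>m. \<Sum>i\<in>UNIV. 2 * lam * (orth_proj (S m) y $ i)\<^sup>2 + orth_proj (S m) (axis i 1) $ i)
     = avg lam y (\<lambda>m. 2 * lam * (norm (orth_proj (S m) y))\<^sup>2 + dim (S m))"
    unfolding avg_def
    by (intro arg_cong2[where f="(/)"] sum.cong refl)
       (simp add: sum.distrib n sum_distrib_left[symmetric] trace_orth_proj sub)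
  finally show ?thesis
    by (simp add: avg_add avg_cmult algebra_simps)
qed

lemma abs_partial_le:
  assumes lam: "lam \<ge> 0"
  shows "\<bar>partial lam i y\<bar> \<le> 1 + 4 * lam * (norm y)\<^sup>2"
proof -
  have P: "(orth_proj (S m) y $ i)\<^sup>2 \<le> (norm y)\<^sup>2" if "m \<in> M" for m
    using component_le_norm_cart[of "orth_proj (S m) y" i] norm_orth_proj_le[OF sub[OF that], of y]
    by (metis abs_ge_zero order_trans power2_abs power_mono)
  have E: "(est lam y $ i)\<^sup>2 \<le> (norm y)\<^sup>2"
    using component_le_norm_cart[of "est lam y" i] norm_est_le[of lam y]
    by (metis abs_ge_zero order_trans power2_abs power_mono)
  have A: "\<bar>orth_proj (S m) (axis i 1) $ i\<bar> \<le> 1" if "m \<in> M" for m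
    using component_le_norm_cart[of "orth_proj (S m) (axis i 1)" i] norm_orth_proj_le[OF sub[OF that], of "axis i 1"]
    by simp
  have "avg lam y (\<lambda>m. 2 * lam * (orth_proj (S m) y $ i)\<^sup>2 + orth_proj (S m) (axis i 1) $ i)
      \<le> avg lam y (\<lambda>_. 2 * lam * (norm y)\<^sup>2 + 1)"
    using P A lam by (intro avg_mono add_mono mult_left_mono) (auto simp: abs_le_iff)
  moreover have "avg lam y (\<lambda>m. 2 * lam * (orth_proj (S m) y $ i)\<^sup>2 + orth_proj (S m) (axis i 1) $ i)
      \<ge> avg lam y (\<lambda>_. 2 * lam * 0 + (- 1))"
    using A lam by (intro avg_mono add_mono mult_left_mono) (auto simp: abs_le_iff minus_le_iff)
  moreover have "2 * lam * (est lam y $ i)\<^sup>2 \<le> 2 * lam * (norm y)\<^sup>2" "0 \<le> 2 * lam * (est lam y $ i)\<^sup>2"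
    "0 \<le> 2 * lam * (norm y)\<^sup>2"
    using lam E by (auto intro!: mult_left_mono)
  ultimately show ?thesis
    unfolding partial_def avg_const by (simp add: abs_le_iff)
qed

lemma partial_derivative:
  "((\<lambda>t. est lam (y + t *\<^sub>R axis i 1) $ i) has_real_derivative partial lam i y) (at 0)"
proof -
  let ?p = "\<lambda>m. orth_proj (S m) y" and ?v = "axis i 1 :: real ^ 'n"
  let ?N = "\<Sum>m\<in>M. raw lam y m * (?p m $ i)" and ?Z = "Z lam y"
  \<comment> \<open>Along the line the squared norm is a quadratic polynomial in \<open>t\<close>.
    Since \<open>?p m\<close> lies in \<open>S m\<close>, its inner product with the projected axis
    vector is its coordinate \<open>i\<close>, which gives the linear coefficient.\<close>
  have dn: "((\<lambda>t. (norm (orth_proj (S m) (y + t *\<^sub>R ?v)))\<^sup>2) has_real_derivative 2 * (?p m $ i)) (at 0)"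
    if m: "m \<in> M" for m
  proof -
    have "(norm (orth_proj (S m) (y + t *\<^sub>R ?v)))\<^sup>2
        = (norm (?p m))\<^sup>2 + 2 * t * (?p m $ i) + t\<^sup>2 * (norm (orth_proj (S m) ?v))\<^sup>2" for t
    proof -
      have "?p m \<bullet> orth_proj (S m) ?v = ?p m $ i"
        using orth_proj_inner[OF sub[OF m] orth_proj_mem[OF sub[OF m]], of ?v y]
        by (simp add: inner_commute[of "?p m"] inner_axis')
      then show ?thesis
        unfolding power2_norm_eq_inner
        by (simp add: orth_proj_add orth_proj_scaleR sub m inner_add_left inner_add_right
            inner_commute power2_eq_square algebra_simps)
    qed
    then show ?thesis by (auto intro!: derivative_eq_intros)
  qed
  have dr: "((\<lambda>t. raw lam (y + t *\<^sub>R ?v) m) has_real_derivative raw lam y m * (2 * lam * (?p m $ i))) (at 0)"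
    if m: "m \<in> M" for m
    unfolding raw_def
    by (rule derivative_eq_intros dn[OF m] refl)+ (simp add: orth_proj_add orth_proj_scaleR sub m)
  have dp: "((\<lambda>t. orth_proj (S m) (y + t *\<^sub>R ?v) $ i) has_real_derivative orth_proj (S m) ?v $ i) (at 0)"
    if m: "m \<in> M" for m
    unfolding orth_proj_add[OF sub[OF m]] orth_proj_scaleR[OF sub[OF m]]
    by (auto intro!: derivative_eq_intros)
  have dZ: "((\<lambda>t. Z lam (y + t *\<^sub>R ?v)) has_real_derivative 2 * lam * ?N) (at 0)"
  proof -
    have "((\<lambda>t. Z lam (y + t *\<^sub>R ?v)) has_real_derivative (\<Sum>m\<in>M. raw lam y m * (2 * lam * (?p m $ i)))) (at 0)"
      unfolding Z_def by (rule DERIV_sum) (rule dr)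
    then show ?thesis by (simp add: sum_distrib_left mult_ac)
  qed
  have dN: "((\<lambda>t. \<Sum>m\<in>M. raw lam (y + t *\<^sub>R ?v) m * (orth_proj (S m) (y + t *\<^sub>R ?v) $ i)) has_real_derivative
      (\<Sum>m\<in>M. raw lam y m * (2 * lam * (?p m $ i)\<^sup>2 + orth_proj (S m) ?v $ i))) (at 0)"
    by (rule DERIV_sum, rule DERIV_cong[OF DERIV_mult[OF dr dp]])
       (simp_all add: power2_eq_square algebra_simps)
  have "((\<lambda>t. est lam (y + t *\<^sub>R ?v) $ i) has_real_derivative
      ((\<Sum>m\<in>M. raw lam y m * (2 * lam * (?p m $ i)\<^sup>2 + orth_proj (S m) ?v $ i)) * ?Z - ?N * (2 * lam * ?N)) / (?Z * ?Z)) (at 0)"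
    unfolding est_component avg_def
    using DERIV_divide[OF dN dZ] Z_pos[of lam y] by simp
  moreover have "((\<Sum>m\<in>M. raw lam y m * (2 * lam * (?p m $ i)\<^sup>2 + orth_proj (S m) ?v $ i)) * ?Z - ?N * (2 * lam * ?N)) / (?Z * ?Z)
      = partial lam i y"
    unfolding partial_def est_component avg_def
    using Z_pos[of lam y] by (simp add: field_simps power2_eq_square)
  ultimately show ?thesis by simp
qed

text \<open>The competitor is given by its density \<open>exp \<circ> k\<close> with respect to \<open>\<pi>\<close>, so that no
  logarithm of a vanishing \<open>\<pi> m\<close> occurs.\<close>

lemma gibbs_variational:
  assumes k: "(\<Sum>m\<in>M. \<pi> m * exp (k m)) = 1"
  shows "(\<Sum>m\<in>M. \<pi> m * exp (k m) * (lam * (norm (orth_proj (S m) y))\<^sup>2 - L m - k m))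
    \<le> avg lam y (\<lambda>m. lam * (norm (orth_proj (S m) y))\<^sup>2 - L m)"
proof -
  let ?b = "\<lambda>m. lam * (norm (orth_proj (S m) y))\<^sup>2 - L m"
  let ?q = "\<lambda>m. \<pi> m * exp (k m)"
  \<comment> \<open>The value attained by the competitor. It is compared with the Gibbs average
    through \<open>ln (Z lam y)\<close>, which lies between the two.\<close>
  define c where "c = (\<Sum>m\<in>M. ?q m * (?b m - k m))"
  \<comment> \<open>Jensen's inequality in tangent form, \<open>1 + x \<le> exp x\<close>; the shift
    by \<open>c\<close> makes the linear term vanish.\<close>
  have "1 = (\<Sum>m\<in>M. ?q m * (1 + (?b m - k m - c)))"
  proof -
    have "(\<Sum>m\<in>M. ?q m * (1 + (x m - c))) = (\<Sum>m\<in>M. ?q m) + (\<Sum>m\<in>M. ?q m * x m) - (\<Sum>m\<in>M. ?q m) * c" for x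
      by (simp add: distrib_left right_diff_distrib sum.distrib sum_subtractf sum_distrib_right)
    from this[of "\<lambda>m. ?b m - k m"] show ?thesis
      unfolding k c_def[symmetric] by simp
  qed
  also have "\<dots> \<le> (\<Sum>m\<in>M. ?q m * exp (?b m - k m - c))"
    by (intro sum_mono mult_left_mono) (auto simp: pi_nonneg)
  also have "\<dots> = Z lam y * exp (- c)"
    unfolding Z_def raw_def sum_distrib_right
    by (intro sum.cong refl) (simp add: mult.assoc mult_exp_exp)
  finally have "exp c \<le> Z lam y"
    by (simp add: exp_minus field_simps)
  then have 1: "c \<le> ln (Z lam y)"
    using Z_pos[of lam y] by (simp add: ln_ge_iff)
  have r: "\<pi> m * exp (?b m - ln (Z lam y)) = raw lam y m / Z lam y" for m
    using Z_pos[of lam y] by (simp add: exp_diff[of _ "ln _"] raw_def)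
  \<comment> \<open>The difference between the Gibbs average and \<open>ln (Z lam y)\<close> is the
    relative entropy of the Gibbs weights with respect to \<open>\<pi>\<close>, hence
    nonnegative.\<close>
  have "0 = (\<Sum>m\<in>M. \<pi> m * (exp (?b m - ln (Z lam y)) - 1))"
    using Z_pos[of lam y]
    by (simp add: right_diff_distrib sum_subtractf r pi_sum sum_divide_distrib[symmetric] Z_def[symmetric])
  also have "\<dots> \<le> (\<Sum>m\<in>M. \<pi> m * (exp (?b m - ln (Z lam y)) * (?b m - ln (Z lam y))))"
    by (intro sum_mono mult_left_mono exp_mult_self_ge pi_nonneg)
  also have "\<dots> = avg lam y (\<lambda>m. ?b m - ln (Z lam y))"
    using Z_pos[of lam y]
    by (simp add: avg_def r sum_divide_distrib mult.assoc[symmetric])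
  also have "\<dots> = avg lam y ?b - ln (Z lam y)"
    unfolding avg_diff avg_const ..
  finally show ?thesis using 1 by (simp add: c_def)
qed

text \<open>Up to the constant \<open>n \<sigma>\<^sup>2\<close> the left-hand side is Stein's unbiased estimate of the risk. The
  spread of the projections around \<open>est lam y\<close> is at most their spread around \<open>orth_proj T y\<close>, and
  the lower bound on \<open>L\<close> absorbs the dimension term of the divergence.\<close>

lemma unbiased_risk_le:
  assumes T: "subspace T" "\<And>m. m \<in> M \<Longrightarrow> S m \<subseteq> T"
    and L: "\<And>m. m \<in> M \<Longrightarrow> L m \<ge> real (dim (S m)) / 2"
    and lam: "lam > 0"
    and k: "(\<Sum>m\<in>M. \<pi> m * exp (k m)) = 1"
  shows "(norm (y - est lam y))\<^sup>2 + 2 * \<sigma>\<^sup>2 * (\<Sum>i\<in>UNIV. partial lam i y)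
    \<le> (norm y)\<^sup>2 - (norm (orth_proj T y))\<^sup>2 + max 1 (4 * \<sigma>\<^sup>2 * lam) *
        (\<Sum>m\<in>M. \<pi> m * exp (k m) *
          ((norm (orth_proj T y))\<^sup>2 - (norm (orth_proj (S m) y))\<^sup>2 + (L m + k m) / lam))"
    (is "_ \<le> _ + max 1 ?c * ?F")
proof -
  define a where "a = avg lam y (\<lambda>m. (norm (orth_proj (S m) y))\<^sup>2)"
  define E where "E = (norm (est lam y))\<^sup>2"
  define t where "t = (norm (orth_proj T y))\<^sup>2"
  define d where "d = avg lam y (\<lambda>m. dim (S m))"
  define l where "l = avg lam y L"
  have y: "y \<bullet> est lam y = a"
    unfolding inner_est a_def avg_def
    by (intro arg_cong2[where f="(/)"] sum.cong refl) (simp add: orth_proj_inner_self sub)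
  have X: "orth_proj T y \<bullet> est lam y = a"
    unfolding inner_est a_def avg_def
    by (intro arg_cong2[where f="(/)"] sum.cong refl)
       (metis (no_types, lifting) T orth_proj_inner_self orth_proj_inner orth_proj_mem sub subset_iff)
  have loss: "(norm (y - est lam y))\<^sup>2 = (norm y)\<^sup>2 - 2 * a + E"
    unfolding E_def power2_norm_eq_inner using y
    by (simp add: inner_diff_left inner_diff_right inner_commute)
  have "0 \<le> (norm (orth_proj T y - est lam y))\<^sup>2" by simp
  also have "\<dots> = t - 2 * a + E"
    unfolding E_def t_def power2_norm_eq_inner using X
    by (simp add: inner_diff_left inner_diff_right inner_commute)
  finally have aE: "a - E \<le> t - a" by simp
  have "E \<le> a"
  proof -
    have "0 \<le> avg lam y (\<lambda>m. (norm (orth_proj (S m) y - est lam y))\<^sup>2)"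
      by (rule avg_nonneg) simp
    also have "\<dots> = avg lam y (\<lambda>m. (norm (orth_proj (S m) y))\<^sup>2 - 2 * (est lam y \<bullet> orth_proj (S m) y) + E)"
      unfolding E_def power2_norm_eq_inner
      by (simp add: inner_diff_left inner_diff_right inner_commute algebra_simps)
    also have "\<dots> = a - 2 * E + E"
      unfolding avg_add avg_diff avg_cmult avg_const inner_est[symmetric]
      by (simp add: a_def E_def power2_norm_eq_inner)
    finally show ?thesis by simp
  qed
  have dl: "d \<le> 2 * l"
  proof -
    have "d \<le> avg lam y (\<lambda>m. 2 * L m)"
      unfolding d_def by (intro avg_mono) (use L in force)
    then show ?thesis by (simp add: avg_cmult l_def)
  qed
  have d0: "0 \<le> d"
    unfolding d_def by (rule avg_nonneg) simp
  have Fw: "t - a + l / lam \<le> ?F"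
  proof -
    let ?q = "\<lambda>m. \<pi> m * exp (k m)" and ?n = "\<lambda>m. (norm (orth_proj (S m) y))\<^sup>2"
    have "lam * ?F = (\<Sum>m\<in>M. ?q m * (lam * t) - ?q m * (lam * ?n m - L m - k m))"
      unfolding sum_distrib_left t_def[symmetric]
      by (intro sum.cong refl) (use lam in \<open>simp add: field_simps\<close>)
    also have "\<dots> = lam * t - (\<Sum>m\<in>M. ?q m * (lam * ?n m - L m - k m))"
      unfolding sum_subtractf sum_distrib_right[symmetric] k by simp
    also have "\<dots> \<ge> lam * t - avg lam y (\<lambda>m. lam * ?n m - L m)"
      using gibbs_variational[OF k] by simp
    also have "avg lam y (\<lambda>m. lam * ?n m - L m) = lam * a - l"
      unfolding avg_diff avg_cmult a_def l_def ..
    finally have "lam * (t - a + l / lam) \<le> lam * ?F"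
      using lam by (simp add: algebra_simps)
    then show ?thesis using lam by simp
  qed
  have lhs: "(norm (y - est lam y))\<^sup>2 + 2 * \<sigma>\<^sup>2 * (\<Sum>i\<in>UNIV. partial lam i y)
      = (norm y)\<^sup>2 - 2 * a + E + ?c * (a - E) + 2 * \<sigma>\<^sup>2 * d"
    unfolding loss sum_partial a_def[symmetric] E_def[symmetric] d_def[symmetric]
    by (simp add: algebra_simps)
  have "2 * \<sigma>\<^sup>2 * d \<le> 2 * \<sigma>\<^sup>2 * (2 * l)"
    by (intro mult_left_mono dl) simp
  also have "\<dots> = ?c * (l / lam)" using lam by simp
  finally have sd: "2 * \<sigma>\<^sup>2 * d \<le> ?c * (l / lam)" .
  have l0: "0 \<le> l / lam" using lam d0 dl by simp
  have "(norm y)\<^sup>2 - 2 * a + E + ?c * (a - E) + 2 * \<sigma>\<^sup>2 * d \<le> (norm y)\<^sup>2 - t + max 1 ?c * (t - a + l / lam)"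
  \<comment> \<open>If \<open>?c \<le> 1\<close>, the spread \<open>a - E\<close> at most completes
    \<open>- 2 * a + E\<close> to \<open>- a\<close>. Otherwise only the surplus
    \<open>(?c - 1) * (a - E)\<close> remains, and \<open>aE\<close> bounds it.\<close>
  proof (cases "?c \<le> 1")
    case True
    have "?c * (a - E) \<le> 1 * (a - E)" "?c * (l / lam) \<le> 1 * (l / lam)"
      using True l0 \<open>E \<le> a\<close> by (intro mult_right_mono; simp)+
    then show ?thesis using True sd by (simp add: max_def)
  next
    case False
    have "(?c - 1) * (a - E) \<le> (?c - 1) * (t - a)"
      using False aE by (intro mult_left_mono) auto
    then show ?thesis using False sd by (simp add: max_def algebra_simps)
  qed
  also have "\<dots> \<le> (norm y)\<^sup>2 - t + max 1 ?c * ?F"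
    by (intro add_left_mono mult_left_mono Fw) simp
  finally show ?thesis unfolding lhs t_def .
qed

text \<open>Writing \<mu> as the data minus the noise leaves a cross term between noise and
  estimator, and Stein's identity turns its mean into the mean divergence. The resulting upper bound
  involves only squared norms of projections, whose means are explicit; \<open>k\<close> is
  deterministic, so the competitor passes through the integral.\<close>

lemma risk_fixed_temperature:
  assumes T: "subspace T" "\<And>m. m \<in> M \<Longrightarrow> S m \<subseteq> T"
    and L: "\<And>m. m \<in> M \<Longrightarrow> L m \<ge> real (dim (S m)) / 2"
    and lam: "lam > 0" and \<sigma>: "\<sigma> > 0"
    and k: "(\<Sum>m\<in>M. \<pi> m * exp (k m)) = 1"
  shows "(\<integral>x. (norm (\<mu> - est lam (\<mu> + \<sigma> *\<^sub>R x)))\<^sup>2 \<partial>std_gauss)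
    \<le> (norm \<mu>)\<^sup>2 - (norm (orth_proj T \<mu>))\<^sup>2 - \<sigma>\<^sup>2 * dim T + max 1 (4 * \<sigma>\<^sup>2 * lam) *
        (\<Sum>m\<in>M. \<pi> m * exp (k m) *
          ((norm (orth_proj T \<mu>))\<^sup>2 - (norm (orth_proj (S m) \<mu>))\<^sup>2
            + \<sigma>\<^sup>2 * (real (dim T) - real (dim (S m))) + (L m + k m) / lam))"
proof -
  interpret prob_space "std_gauss :: (real ^ 'n) measure" by (rule prob_space_std_gauss)
  let ?y = "\<lambda>x. \<mu> + \<sigma> *\<^sub>R x"
  let ?h = "\<lambda>x. est lam (?y x)"
  let ?D = "\<lambda>i x. \<sigma> * partial lam i (?y x)"
  \<comment> \<open>Coarse growth constants common to \<open>?h\<close> and \<open>?D\<close>, from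
    \<open>ny\<close>, \<open>ny2\<close> and \<open>abs_partial_le\<close>.\<close>
  define A where "A = norm \<mu> + \<sigma> * (1 + 8 * lam * (norm \<mu>)\<^sup>2)"
  define B where "B = \<sigma> + \<sigma> * (8 * lam * \<sigma>\<^sup>2)"
  have ny: "norm (?y x) \<le> norm \<mu> + \<sigma> * norm x" for x
    using norm_triangle_ineq[of \<mu> "\<sigma> *\<^sub>R x"] \<sigma> by simp
  have ny2: "(norm (?y x))\<^sup>2 \<le> 2 * (norm \<mu>)\<^sup>2 + 2 * \<sigma>\<^sup>2 * (norm x)\<^sup>2" for x
  proof -
    have "(norm (?y x))\<^sup>2 \<le> (norm \<mu> + \<sigma> * norm x)\<^sup>2"
      by (intro power_mono ny) simp
    also have "\<dots> \<le> 2 * (norm \<mu>)\<^sup>2 + 2 * \<sigma>\<^sup>2 * (norm x)\<^sup>2"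
      using sum_squares_bound[of "norm \<mu>" "\<sigma> * norm x"] by (simp add: power2_sum power_mult_distrib)
    finally show ?thesis .
  qed
  have cont_y: "continuous_on UNIV ?y" by (intro continuous_intros)
  have D: "((\<lambda>t. ?h (x + t *\<^sub>R axis i 1) $ i) has_real_derivative ?D i x) (at 0)" for i x
  proof -
    have "((\<lambda>t. est lam (?y x + t *\<^sub>R axis i 1) $ i) has_real_derivative partial lam i (?y x)) (at (\<sigma> * 0))"
      using partial_derivative by simp
    then have "((\<lambda>t. est lam (?y x + (\<sigma> * t) *\<^sub>R axis i 1) $ i) has_real_derivative partial lam i (?y x) * \<sigma>) (at 0)"
      by (rule DERIV_chain2[where g="\<lambda>t. \<sigma> * t"]) (auto intro!: derivative_eq_intros)
    then show ?thesis by (simp add: algebra_simps)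
  qed
  have ch: "continuous_on UNIV ?h"
    by (rule continuous_on_compose2[OF continuous_on_est cont_y]) auto
  have cD: "continuous_on UNIV (?D i)" for i
    by (intro continuous_intros continuous_on_compose2[OF continuous_on_partial cont_y]) auto
  have A0: "0 \<le> A" and B0: "0 \<le> B" using \<sigma> lam by (simp_all add: A_def B_def)
  have bh: "norm (?h x) \<le> A + B * norm x" for x
  proof -
    have "norm (?h x) \<le> norm \<mu> + \<sigma> * norm x"
      using norm_est_le ny order_trans by blast
    also have "\<dots> \<le> A + B * norm x"
      using \<sigma> lam by (simp add: A_def B_def distrib_right)
    finally show ?thesis .
  qed
  have bD: "\<bar>?D i x\<bar> \<le> A + B * (norm x)\<^sup>2" for i x
  proof -
    have "\<bar>partial lam i (?y x)\<bar> \<le> 1 + 4 * lam * (2 * (norm \<mu>)\<^sup>2 + 2 * \<sigma>\<^sup>2 * (norm x)\<^sup>2)"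
    proof -
      have "4 * lam * (norm (?y x))\<^sup>2 \<le> 4 * lam * (2 * (norm \<mu>)\<^sup>2 + 2 * \<sigma>\<^sup>2 * (norm x)\<^sup>2)"
        by (intro mult_left_mono ny2) (use lam in simp)
      then show ?thesis using abs_partial_le[of lam i "?y x"] lam by linarith
    qed
    then have "\<bar>?D i x\<bar> \<le> \<sigma> * (1 + 4 * lam * (2 * (norm \<mu>)\<^sup>2 + 2 * \<sigma>\<^sup>2 * (norm x)\<^sup>2))"
      using \<sigma> by (simp add: abs_mult mult_left_mono)
    also have "\<dots> \<le> A + B * (norm x)\<^sup>2"
      using \<sigma> by (simp add: A_def B_def algebra_simps)
    finally show ?thesis .
  qed
  note st = stein_std_gauss[where h="?h" and D="?D", OF D ch cD A0 B0 bh bD]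
  note i\<mu> = std_gauss_inner[of \<mu>]
  have PU: "orth_proj UNIV y = y" for y :: "real ^ 'n"
    by (rule orth_proj_self) auto
  have iY: "integrable std_gauss (\<lambda>x. (norm (?y x))\<^sup>2)"
    "(\<integral>x. (norm (?y x))\<^sup>2 \<partial>std_gauss) = (norm \<mu>)\<^sup>2 + \<sigma>\<^sup>2 * CARD('n)"
    using std_gauss_orth_proj[OF subspace_UNIV, of \<mu> \<sigma>] by (simp_all add: PU)
  have iX: "integrable std_gauss (\<lambda>x. (norm (x :: real ^ 'n))\<^sup>2)"
    "(\<integral>x. (norm (x :: real ^ 'n))\<^sup>2 \<partial>std_gauss) = CARD('n)"
    using std_gauss_orth_proj[OF subspace_UNIV, of "0 :: real ^ 'n" 1] by (simp_all add: PU)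
  note iT = std_gauss_orth_proj[OF T(1), of \<mu> \<sigma>]
  note iS = std_gauss_orth_proj[OF sub, of _ \<mu> \<sigma>]
  have split: "(norm (\<mu> - ?h x))\<^sup>2 = (norm (?y x - ?h x))\<^sup>2 - 2 * \<sigma> * (x \<bullet> \<mu>) + 2 * \<sigma> * (x \<bullet> ?h x) - \<sigma>\<^sup>2 * (norm x)\<^sup>2" for x
    unfolding power2_norm_eq_inner
    by (simp add: inner_diff_left inner_diff_right inner_add_left inner_add_right inner_commute
        power2_eq_square algebra_simps)
  have iR: "integrable std_gauss (\<lambda>x. (norm (?y x - ?h x))\<^sup>2)"
  proof (rule integrable_std_gauss_quadratic[where A="8 * (norm \<mu>)\<^sup>2" and B="8 * \<sigma>\<^sup>2"])
    show "(\<lambda>x. (norm (?y x - ?h x))\<^sup>2) \<in> borel_measurable borel"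
      by (intro borel_measurable_continuous_onI continuous_intros ch)
    show "\<bar>(norm (?y x - ?h x))\<^sup>2\<bar> \<le> 8 * (norm \<mu>)\<^sup>2 + 8 * \<sigma>\<^sup>2 * (norm x)\<^sup>2" for x
    proof -
      have "norm (?y x - ?h x) \<le> 2 * norm (?y x)"
        using norm_triangle_ineq4[of "?y x" "?h x"] norm_est_le[of lam "?y x"] by linarith
      then have "(norm (?y x - ?h x))\<^sup>2 \<le> (2 * norm (?y x))\<^sup>2"
        by (intro power_mono) auto
      then show ?thesis using ny2[of x] by (simp add: power_mult_distrib)
    qed
  qed
  define p where "p x = (\<Sum>i\<in>UNIV. partial lam i (?y x))" for x
  define F where "F x = (\<Sum>m\<in>M. \<pi> m * exp (k m) *
      ((norm (orth_proj T (?y x)))\<^sup>2 - (norm (orth_proj (S m) (?y x)))\<^sup>2 + (L m + k m) / lam))" for x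
  define Fbar where "Fbar = (\<Sum>m\<in>M. \<pi> m * exp (k m) *
          (((norm (orth_proj T \<mu>))\<^sup>2 + \<sigma>\<^sup>2 * dim T) - ((norm (orth_proj (S m) \<mu>))\<^sup>2 + \<sigma>\<^sup>2 * dim (S m)) + (L m + k m) / lam))"
  let ?c = "max 1 (4 * \<sigma>\<^sup>2 * lam)"
  have sD: "(\<lambda>x. \<Sum>i\<in>UNIV. ?D i x) = (\<lambda>x. \<sigma> * p x)"
    by (simp add: p_def sum_distrib_left)
  have ip: "integrable std_gauss p"
    using st(2) \<sigma> unfolding sD by simp
  have Ep: "(\<integral>x. x \<bullet> ?h x \<partial>std_gauss) = \<sigma> * (\<integral>x. p x \<partial>std_gauss)"
    unfolding st(3) sD by simp
  have iF: "integrable std_gauss F" "(\<integral>x. F x \<partial>std_gauss) = Fbar"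
  proof -
    let ?f = "\<lambda>m x. \<pi> m * exp (k m) * ((norm (orth_proj T (?y x)))\<^sup>2 - (norm (orth_proj (S m) (?y x)))\<^sup>2 + (L m + k m) / lam)"
    have f: "integrable std_gauss (?f m)"
      "(\<integral>x. ?f m x \<partial>std_gauss) = \<pi> m * exp (k m) *
          (((norm (orth_proj T \<mu>))\<^sup>2 + \<sigma>\<^sup>2 * dim T) - ((norm (orth_proj (S m) \<mu>))\<^sup>2 + \<sigma>\<^sup>2 * dim (S m)) + (L m + k m) / lam)"
      if "m \<in> M" for m
      using iT iS[OF that] prob_space by simp_all
    show "integrable std_gauss F"
      unfolding F_def[abs_def] by (rule Bochner_Integration.integrable_sum) (rule f)
    show "(\<integral>x. F x \<partial>std_gauss) = Fbar"
      unfolding F_def Fbar_def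
      by (subst Bochner_Integration.integral_sum, rule f, assumption, intro sum.cong refl, rule f)
  qed
  have "(\<integral>x. (norm (\<mu> - ?h x))\<^sup>2 \<partial>std_gauss) = (\<integral>x. (norm (?y x - ?h x))\<^sup>2 \<partial>std_gauss)
      + 2 * \<sigma> * (\<integral>x. x \<bullet> ?h x \<partial>std_gauss) - \<sigma>\<^sup>2 * CARD('n)"
    unfolding split using iR i\<mu> st(1) iX by simp
  also have "\<dots> = (\<integral>x. (norm (?y x - ?h x))\<^sup>2 + 2 * \<sigma>\<^sup>2 * p x \<partial>std_gauss) - \<sigma>\<^sup>2 * CARD('n)"
    unfolding Ep using iR ip by (simp add: power2_eq_square)
  also have "(\<integral>x. (norm (?y x - ?h x))\<^sup>2 + 2 * \<sigma>\<^sup>2 * p x \<partial>std_gauss)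
      \<le> (\<integral>x. (norm (?y x))\<^sup>2 - (norm (orth_proj T (?y x)))\<^sup>2 + ?c * F x \<partial>std_gauss)"
  proof (rule integral_mono)
    show "integrable std_gauss (\<lambda>x. (norm (?y x - ?h x))\<^sup>2 + 2 * \<sigma>\<^sup>2 * p x)" using iR ip by simp
    show "integrable std_gauss (\<lambda>x. (norm (?y x))\<^sup>2 - (norm (orth_proj T (?y x)))\<^sup>2 + ?c * F x)"
      using iF(1) iY(1) iT(1) by simp
    show "(norm (?y x - ?h x))\<^sup>2 + 2 * \<sigma>\<^sup>2 * p x \<le> (norm (?y x))\<^sup>2 - (norm (orth_proj T (?y x)))\<^sup>2 + ?c * F x" for x
      unfolding p_def F_def by (rule unbiased_risk_le[OF T L lam k])
  qed
  also have "\<dots> = (norm \<mu>)\<^sup>2 + \<sigma>\<^sup>2 * CARD('n) - ((norm (orth_proj T \<mu>))\<^sup>2 + \<sigma>\<^sup>2 * dim T) + ?c * Fbar"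
    using iF iY iT by simp
  finally have "(\<integral>x. (norm (\<mu> - ?h x))\<^sup>2 \<partial>std_gauss)
      \<le> (norm \<mu>)\<^sup>2 - (norm (orth_proj T \<mu>))\<^sup>2 - \<sigma>\<^sup>2 * dim T + ?c * Fbar" by simp
  also have "Fbar = (\<Sum>m\<in>M. \<pi> m * exp (k m) *
          ((norm (orth_proj T \<mu>))\<^sup>2 - (norm (orth_proj (S m) \<mu>))\<^sup>2
            + \<sigma>\<^sup>2 * (real (dim T) - real (dim (S m))) + (L m + k m) / lam))"
    unfolding Fbar_def by (intro sum.cong refl) (simp add: algebra_simps)
  finally show ?thesis .
qed

end

section \<open>The excess of the variance ratio\<close>

lemma phi_pos:
  assumes "0 < x" "x < 1" shows "phi x > 0"
  using assms ln_le_minus_one[of x] ln_eq_minus_one[of x]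
  by (auto simp: phi_def less_le)

text \<open>This inequality produces the factor 1/2 in \<epsilon>_n. The bound
  \<open>ln z \<le> z - 1\<close> at z = 1 / x would give only 2 (1 - x)^2, which exceeds 1 - x for
  x < 1/2; applied to the square root it is sharp enough.\<close>

lemma phi_le:
  assumes x: "0 < x" "x < 1" shows "4 * x * phi x \<le> 1 - x"
proof -
  define u where "u = sqrt x"
  have u: "0 < u" "u < 1" "x = u\<^sup>2" using x by (auto simp: u_def)
  have "ln (1 / u) \<le> 1 / u - 1" using u by (intro ln_le_minus_one) auto
  then have "- ln x \<le> 2 * (1 / u - 1)"
    using u by (simp add: ln_div ln_realpow)
  then have "x * (- ln x) \<le> x * (2 * (1 / u - 1))"
    using x by (intro mult_left_mono) auto
  also have "\<dots> = 2 * u - 2 * u\<^sup>2" using u by (simp add: field_simps power2_eq_square)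
  finally have le: "x * (- ln x) \<le> 2 * u - 2 * u\<^sup>2" .
  have "4 * x * phi x = 2 * (x * x - x + x * (- ln x))"
    by (simp add: phi_def field_simps)
  also have "\<dots> \<le> 2 * (x * x - x + (2 * u - 2 * u\<^sup>2))"
    by (intro mult_left_mono add_left_mono le) simp
  also have "\<dots> = 2 * (u\<^sup>2 * u\<^sup>2 - u\<^sup>2 + 2 * u - 2 * u\<^sup>2)"
    unfolding u(3) by simp
  also have "\<dots> = (1 - u) * ((2 * u * (1 - u)) * (u + 2))"
    by (simp add: algebra_simps power2_eq_square)
  also have "\<dots> \<le> (1 - u) * (1 / 2 * (u + 2))"
  proof (intro mult_left_mono mult_right_mono)
    have "0 \<le> (2 * u - 1)\<^sup>2" by simp
    then show "2 * u * (1 - u) \<le> 1 / 2" by (simp add: power2_eq_square algebra_simps)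
  qed (use u in auto)
  also have "\<dots> \<le> (1 - u) * (1 + u)"
    using u by (intro mult_left_mono) auto
  also have "\<dots> = 1 - x" using u by (simp add: algebra_simps power2_eq_square)
  finally show ?thesis .
qed

text \<open>For \<open>v > 0\<close> this trades the singular factor 1 / v for exponentials. The
  value \<infinity> at \<open>v = 0\<close> is kept, so that a finite expectation later shows that
  the residual vanishes only on a null set.\<close>

lemma nn_integral_exp_tail:
  assumes v: "v \<ge> 0"
  shows "(\<integral>\<^sup>+s. ennreal (exp (- s * v)) * indicator {t..} s \<partial>lborel) = (if v = 0 then \<infinity> else ennreal (exp (- t * v) / v))"
proof (cases "v = 0")
  case True
  have "(\<integral>\<^sup>+s. ennreal (exp (- s * v)) * indicator {t..} s \<partial>lborel) = emeasure lborel {t..}"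
    using True by simp
  also have "\<dots> = \<infinity>"
  proof -
    have "ennreal (real n) \<le> emeasure lborel {t..}" for n
    proof -
      have "emeasure lborel {t..t + real n} \<le> emeasure lborel {t..}"
        by (intro emeasure_mono) auto
      then show ?thesis by simp
    qed
    then show ?thesis
      by (metis ennreal_Ex_less_of_nat ennreal_of_nat_eq_real_of_nat infinity_ennreal_def leD less_top)
  qed
  finally show ?thesis using True by simp
next
  case False
  then have v: "v > 0" using v by simp
  have "(\<integral>\<^sup>+s. ennreal (exp (- s * v)) * indicator {t..} s \<partial>lborel) = ennreal (0 - (- exp (- t * v) / v))"
  proof (rule nn_integral_FTC_atLeast)
    show "((\<lambda>s. - exp (- s * v) / v) has_real_derivative exp (- s * v)) (at s)" for s
      using v by (auto intro!: derivative_eq_intros)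
    have "((\<lambda>s. - exp (- s * v) / v) \<longlongrightarrow> - 0 / v) at_top"
      using v by (intro tendsto_intros) (real_asymp, auto)
    then show "((\<lambda>s. - exp (- s * v) / v) \<longlongrightarrow> 0) at_top" by simp
  qed auto
  then show ?thesis using False by simp
qed

lemma nn_integral_laplace_tail:
  fixes N :: nat
  assumes t: "t \<ge> 0" and N: "N > 2"
  shows "(\<integral>\<^sup>+s. ennreal ((1 / sqrt (1 + 2 * s)) ^ N) * indicator {t..} s \<partial>lborel)
    = ennreal ((1 + 2 * t) powr (1 - N / 2) / (real N - 2))"
proof -
  have N': "real N > 2" using N by simp
  have "(\<integral>\<^sup>+s. ennreal ((1 / sqrt (1 + 2 * s)) ^ N) * indicator {t..} s \<partial>lborel)
      = ennreal (0 - (- ((1 + 2 * t) powr (1 - N / 2)) / (real N - 2)))"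
  proof (rule nn_integral_FTC_atLeast)
    fix s assume "t \<le> s"
    then have s: "1 + 2 * s > 0" using t by simp
    have "(1 / sqrt (1 + 2 * s)) ^ N = (1 + 2 * s) powr (- N / 2)"
      using s by (simp add: powr_half_sqrt[symmetric] powr_realpow[symmetric] powr_divide powr_powr powr_minus_divide)
    moreover have "((\<lambda>s. (1 + 2 * s) powr (1 - N / 2)) has_real_derivative (2 - real N) * (1 + 2 * s) powr (- N / 2)) (at s)"
      using s by (auto intro!: derivative_eq_intros simp: algebra_simps)
    from DERIV_cdivide[OF DERIV_minus[OF this], of "real N - 2"]
    have "((\<lambda>s. - ((1 + 2 * s) powr (1 - N / 2)) / (real N - 2)) has_real_derivative (1 + 2 * s) powr (- N / 2)) (at s)"
      by (rule DERIV_cong) (use N' in \<open>simp add: field_simps\<close>)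
    ultimately show "((\<lambda>s. - ((1 + 2 * s) powr (1 - N / 2)) / (real N - 2)) has_real_derivative (1 / sqrt (1 + 2 * s)) ^ N) (at s)"
      by simp
    show "0 \<le> (1 / sqrt (1 + 2 * s)) ^ N" using s by simp
  next
    have "((\<lambda>s. (1 + 2 * s) powr (1 - N / 2)) \<longlongrightarrow> 0) at_top"
      using N' by real_asymp
    then have "((\<lambda>s. - ((1 + 2 * s) powr (1 - N / 2)) / (real N - 2)) \<longlongrightarrow> - 0 / (real N - 2)) at_top"
      using N' by (intro tendsto_intros) auto
    then show "((\<lambda>s. - ((1 + 2 * s) powr (1 - N / 2)) / (real N - 2)) \<longlongrightarrow> 0) at_top" by simp
  qed auto
  then show ?thesis by simp
qed

text \<open>Tonelli's theorem: as an integral of \<open>exp (- s * V y)\<close> over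
  \<open>s \<ge> t\<close>, the inverse moment reduces to the Laplace transform of \<open>V\<close>,
  and the density of a noncentral chi-square law does not enter.\<close>

lemma nn_integral_exp_residual_tail:
  fixes T :: "(real ^ 'n) set"
  assumes T: "subspace T" and c: "orth_proj T c = 0" and t: "t \<ge> 0" and N: "resid_dim T > 2"
  defines "V \<equiv> \<lambda>y. (norm (c + (y - orth_proj T y)))\<^sup>2"
  shows "(\<integral>\<^sup>+y. (if V y = 0 then \<infinity> else ennreal (exp (- t * V y) / V y)) \<partial>std_gauss)
    \<le> ennreal ((1 + 2 * t) powr (1 - resid_dim T / 2) / (real (resid_dim T) - 2))"
proof -
  interpret prob_space "std_gauss :: (real ^ 'n) measure" by (rule prob_space_std_gauss)
  interpret pair_sigma_finite "std_gauss :: (real ^ 'n) measure" "lborel :: real measure"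
    by (intro pair_sigma_finite.intro sigma_finite_measure_axioms sigma_finite_lborel)
  note [measurable] = orth_proj_measurable[OF T]
  have [measurable]: "V \<in> borel_measurable borel" unfolding V_def by measurable
  have "(\<integral>\<^sup>+y. (if V y = 0 then \<infinity> else ennreal (exp (- t * V y) / V y)) \<partial>std_gauss)
      = (\<integral>\<^sup>+y. \<integral>\<^sup>+s. ennreal (exp (- s * V y)) * indicator {t..} s \<partial>lborel \<partial>std_gauss)"
    by (intro nn_integral_cong nn_integral_exp_tail[symmetric]) (simp add: V_def)
  also have "\<dots> = (\<integral>\<^sup>+s. \<integral>\<^sup>+y. ennreal (exp (- s * V y)) * indicator {t..} s \<partial>std_gauss \<partial>lborel)"
    by (rule Fubini'[symmetric]) measurable
  also have "\<dots> = (\<integral>\<^sup>+s. (\<integral>\<^sup>+y. ennreal (exp (- s * V y)) \<partial>std_gauss) * indicator {t..} s \<partial>lborel)"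
    by (intro nn_integral_cong nn_integral_multc) measurable
  also have "\<dots> \<le> (\<integral>\<^sup>+s. ennreal ((1 / sqrt (1 + 2 * s)) ^ resid_dim T) * indicator {t..} s \<partial>lborel)"
    unfolding V_def using nn_integral_std_gauss_exp_residual[OF T _ c] t
    by (intro nn_integral_mono) (auto simp: indicator_def)
  also have "\<dots> = ennreal ((1 + 2 * t) powr (1 - resid_dim T / 2) / (real (resid_dim T) - 2))"
    by (rule nn_integral_laplace_tail[OF t N])
  finally show ?thesis .
qed

text \<open>Since \<open>t (a - V) \<le> exp (t (a - V) - 1)\<close>, the positive part of \<open>a / V - 1\<close> is at most a
  multiple of \<open>exp (- t V) / V\<close>, the integral of \<open>exp (- s V)\<close> over \<open>s \<ge> t\<close>. The choice
  \<open>1 + 2 t = 1 / x\<close> is the optimal Chernoff exponent.\<close>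

lemma excess_ratio:
  fixes T :: "(real ^ 'n) set"
  assumes T: "subspace T" and c: "orth_proj T c = 0" and x: "0 < x" "x < 1" and n: "n > (1::real)"
    and N: "real (resid_dim T) \<ge> 2 + ln n / phi x"
  defines "V \<equiv> \<lambda>y. (norm (c + (y - orth_proj T y)))\<^sup>2"
  defines "\<rho> \<equiv> \<lambda>y. max 0 (x * resid_dim T / V y - 1)"
  shows "AE y in std_gauss. V y > 0" "integrable std_gauss \<rho>" "(\<integral>y. \<rho> y \<partial>std_gauss) \<le> 1 / (2 * n * ln n)"
proof -
  let ?N = "real (resid_dim T)"
  define t where "t = (1 - x) / (2 * x)"
  have t: "t > 0" "1 + 2 * t = 1 / x" using x by (auto simp: t_def field_simps)
  have ph: "phi x > 0" by (rule phi_pos[OF x])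
  have ln: "ln n > 0" using n by simp
  have N2: "?N - 2 \<ge> ln n / phi x" using N by simp
  then have N0: "?N - 2 > 0" using ph ln by (metis divide_pos_pos less_le_trans)
  have N3: "resid_dim T > 2" using N0 by simp
  let ?B = "(1 + 2 * t) powr (1 - ?N / 2) / (?N - 2)"
  note [measurable] = orth_proj_measurable[OF T]
  have Vm [measurable]: "V \<in> borel_measurable borel" unfolding V_def by measurable
  have V0: "V y \<ge> 0" for y by (simp add: V_def)
  have K: "(\<integral>\<^sup>+y. (if V y = 0 then \<infinity> else ennreal (exp (- t * V y) / V y)) \<partial>std_gauss) \<le> ennreal ?B"
    unfolding V_def by (rule nn_integral_exp_residual_tail[OF T c _ N3]) (use t in simp)
  have "AE y in std_gauss. (if V y = 0 then \<infinity> else ennreal (exp (- t * V y) / V y)) \<noteq> \<infinity>"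
  proof (rule nn_integral_PInf_AE)
    show "(\<lambda>y. if V y = 0 then \<infinity> else ennreal (exp (- t * V y) / V y)) \<in> borel_measurable std_gauss"
      by measurable
    show "(\<integral>\<^sup>+y. (if V y = 0 then \<infinity> else ennreal (exp (- t * V y) / V y)) \<partial>std_gauss) \<noteq> \<infinity>"
      using K by (metis ennreal_less_top infinity_ennreal_def leD)
  qed
  then show "AE y in std_gauss. V y > 0"
    by eventually_elim (use V0 in \<open>auto simp: less_le split: if_splits\<close>)
  define C where "C = exp (t * (x * ?N) - 1) / t"
  have C: "C \<ge> 0" using t by (simp add: C_def)
  have pt: "ennreal (\<rho> y) \<le> ennreal C * (if V y = 0 then \<infinity> else ennreal (exp (- t * V y) / V y))" for y
  proof (cases "V y = 0")
    \<comment> \<open>Division by zero yields 0, so \<open>\<rho> y = 0\<close> here.\<close>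
    case True
    then show ?thesis by (simp add: \<rho>_def)
  next
    case False
    then have V: "V y > 0" using V0[of y] by simp
    have "t * (x * ?N - V y) \<le> exp (t * (x * ?N - V y) - 1)"
      using exp_ge_add_one_self[of "t * (x * ?N - V y) - 1"] by simp
    also have "\<dots> = exp (t * (x * ?N) - 1) * exp (- t * V y)"
      by (simp add: mult_exp_exp algebra_simps)
    finally have "x * ?N - V y \<le> C * exp (- t * V y)"
      using t by (simp add: C_def field_simps)
    then have "x * ?N / V y - 1 \<le> C * (exp (- t * V y) / V y)"
      using V divide_right_mono[of "x * ?N - V y" "C * exp (- t * V y)" "V y"] by (simp add: diff_divide_distrib)
    moreover have "0 \<le> C * (exp (- t * V y) / V y)" using C V by simp
    ultimately have "\<rho> y \<le> C * (exp (- t * V y) / V y)" by (simp add: \<rho>_def)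
    then have "ennreal (\<rho> y) \<le> ennreal (C * (exp (- t * V y) / V y))" by (rule ennreal_leI)
    also have "\<dots> = ennreal C * ennreal (exp (- t * V y) / V y)"
      by (rule ennreal_mult) (use C V in auto)
    finally show ?thesis using False by simp
  qed
  have "C * ?B = exp (t * (x * ?N) - 1 + (?N / 2 - 1) * ln x) / (t * (?N - 2))"
  proof -
    have "(1 + 2 * t) powr (1 - ?N / 2) = exp ((?N / 2 - 1) * ln x)"
      unfolding t(2) using x by (simp add: powr_def ln_div algebra_simps)
    then show ?thesis by (simp add: C_def exp_add)
  qed
  \<comment> \<open>Since \<open>t * x = (1 - x) / 2\<close>, the exponent collapses to this form,
    which is the origin of \<open>phi\<close>. The lower bound on \<open>?N - 2\<close> is used
    twice: it makes the exponential at most 1 / n, the term \<open>- x\<close> being dropped, and it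
    bounds the denominator from below.\<close>
  also have "t * (x * ?N) - 1 + (?N / 2 - 1) * ln x = - (?N - 2) * phi x - x"
    unfolding t_def phi_def using x by (simp add: field_simps)
  also have "exp (- (?N - 2) * phi x - x) / (t * (?N - 2)) \<le> (1 / n) / (t * (ln n / phi x))"
  proof (intro frac_le mult_left_mono N2)
    have "ln n \<le> (?N - 2) * phi x" using N2 ph by (simp add: field_simps)
    then have "- (?N - 2) * phi x - x \<le> - ln n" using x by (simp add: algebra_simps)
    then have "exp (- (?N - 2) * phi x - x) \<le> exp (- ln n)" by simp
    then show "exp (- (?N - 2) * phi x - x) \<le> 1 / n" using n by (simp add: exp_minus inverse_eq_divide)
    show "0 < t * (ln n / phi x)" using t ph ln by simp
  qed (use t n in auto)
  also have "\<dots> \<le> 1 / (2 * n * ln n)"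
  proof -
    have "(1 / n) / (t * (ln n / phi x)) = (2 * x * phi x / (1 - x)) / (n * ln n)"
      unfolding t_def using x n ln ph by (simp add: field_simps)
    also have "\<dots> \<le> (1 / 2) / (n * ln n)"
      using phi_le[OF x] x n ln by (intro divide_right_mono) (auto simp: field_simps)
    finally show ?thesis by simp
  qed
  finally have CB: "C * ?B \<le> 1 / (2 * n * ln n)" .
  have "(\<integral>\<^sup>+y. ennreal (\<rho> y) \<partial>std_gauss) \<le> (\<integral>\<^sup>+y. ennreal C * (if V y = 0 then \<infinity> else ennreal (exp (- t * V y) / V y)) \<partial>std_gauss)"
    by (intro nn_integral_mono pt)
  also have "\<dots> = ennreal C * (\<integral>\<^sup>+y. (if V y = 0 then \<infinity> else ennreal (exp (- t * V y) / V y)) \<partial>std_gauss)"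
    by (rule nn_integral_cmult) measurable
  also have "\<dots> \<le> ennreal C * ennreal ?B"
    by (intro mult_left_mono K) simp
  also have "\<dots> = ennreal (C * ?B)"
    by (rule ennreal_mult[symmetric]) (use C N0 in auto)
  also have "\<dots> \<le> ennreal (1 / (2 * n * ln n))"
    by (rule ennreal_leI[OF CB])
  finally have fin: "(\<integral>\<^sup>+y. ennreal (\<rho> y) \<partial>std_gauss) \<le> ennreal (1 / (2 * n * ln n))" .
  have \<rho>m [measurable]: "\<rho> \<in> borel_measurable std_gauss" unfolding \<rho>_def by measurable
  have \<rho>0: "\<rho> y \<ge> 0" for y by (simp add: \<rho>_def)
  show "integrable std_gauss \<rho>"
    by (rule integrableI_bounded)
       (use fin \<rho>0 in \<open>auto intro: le_less_trans\<close>)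
  show "(\<integral>y. \<rho> y \<partial>std_gauss) \<le> 1 / (2 * n * ln n)"
    using fin n ln \<rho>0 by (subst integral_eq_nn_integral) (auto intro!: enn2real_leI)
qed

section \<open>The risk bound\<close>

context gibbs_mixture
begin

text \<open>Joint measurability in temperature and data, since the temperature will be a function of
  the data.\<close>

lemma est_measurable:
  assumes [measurable]: "f \<in> borel_measurable K" "g \<in> borel_measurable K"
  shows "(\<lambda>x. est (f x) (g x)) \<in> borel_measurable K"
proof -
  have [measurable]: "(\<lambda>x. orth_proj (S m) (g x)) \<in> borel_measurable K" if "m \<in> M" for m
    using assms(2) orth_proj_measurable[OF sub[OF that]] by (rule measurable_compose)
  have [measurable]: "(\<lambda>x. raw (f x) (g x) m) \<in> borel_measurable K" if "m \<in> M" for m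
    unfolding raw_def using that by measurable
  show ?thesis
    unfolding est_def Z_def
    by (intro borel_measurable_sum borel_measurable_scaleR borel_measurable_divide) measurable
qed

text \<open>The bound does not involve \<open>lam\<close>, so it also controls the loss at a random
  temperature and gives its integrability.\<close>

lemma loss_le:
  assumes "\<sigma> > 0"
  shows "(norm (\<mu> - est lam (\<mu> + \<sigma> *\<^sub>R x)))\<^sup>2 \<le> 8 * (norm \<mu>)\<^sup>2 + 2 * \<sigma>\<^sup>2 * (norm x)\<^sup>2"
proof -
  have "norm (\<mu> - est lam (\<mu> + \<sigma> *\<^sub>R x)) \<le> norm \<mu> + norm (\<mu> + \<sigma> *\<^sub>R x)"
    using norm_triangle_ineq4[of \<mu> "est lam (\<mu> + \<sigma> *\<^sub>R x)"] norm_est_le[of lam "\<mu> + \<sigma> *\<^sub>R x"] by linarith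
  also have "\<dots> \<le> 2 * norm \<mu> + \<sigma> * norm x"
    using norm_triangle_ineq[of \<mu> "\<sigma> *\<^sub>R x"] assms by simp
  finally have "(norm (\<mu> - est lam (\<mu> + \<sigma> *\<^sub>R x)))\<^sup>2 \<le> (2 * norm \<mu> + \<sigma> * norm x)\<^sup>2"
    by (intro power_mono) auto
  also have "\<dots> \<le> 8 * (norm \<mu>)\<^sup>2 + 2 * \<sigma>\<^sup>2 * (norm x)\<^sup>2"
    using sum_squares_bound[of "2 * norm \<mu>" "\<sigma> * norm x"] by (simp add: power2_sum power_mult_distrib)
  finally show ?thesis .
qed

lemma expected_loss_le:
  fixes n :: real and \<mu> :: "real ^ 'n"
  assumes T: "subspace T" "\<And>m. m \<in> M \<Longrightarrow> S m \<subseteq> T"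
    and L: "\<And>m. m \<in> M \<Longrightarrow> L m \<ge> real (dim (S m)) / 2"
    and \<sigma>: "\<sigma> > 0" and \<beta>: "\<beta> > 0" "\<beta> < 1 / 4" and n: "n > 1"
    and N: "real (resid_dim T) \<ge> 2 + ln n / phi (4 * \<beta>)"
    and k: "(\<Sum>m\<in>M. \<pi> m * exp (k m)) = 1"
  defines "\<sigma>bar2 \<equiv> \<sigma>\<^sup>2 + (norm (\<mu> - orth_proj T \<mu>))\<^sup>2 / resid_dim T"
    and "loss \<equiv> \<lambda>x. (norm (\<mu> - est (\<beta> / var_est T (\<mu> + \<sigma> *\<^sub>R x)) (\<mu> + \<sigma> *\<^sub>R x)))\<^sup>2"
  shows "integrable std_gauss loss"
    and "(\<integral>x. loss x \<partial>std_gauss) \<le> (norm (\<mu> - orth_proj T \<mu>))\<^sup>2 - \<sigma>\<^sup>2 * dim T + (1 + 1 / (2 * n * ln n)) *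
      (\<Sum>m\<in>M. \<pi> m * exp (k m) *
          ((norm (orth_proj T \<mu>))\<^sup>2 - (norm (orth_proj (S m) \<mu>))\<^sup>2
            + \<sigma>\<^sup>2 * (real (dim T) - real (dim (S m))) + \<sigma>bar2 / \<beta> * (L m + k m)))"
proof -
  interpret prob_space "std_gauss :: (real ^ 'n) measure" by (rule prob_space_std_gauss)
  note [measurable] = orth_proj_measurable[OF T(1)] est_measurable
  let ?N = "real (resid_dim T)"
  \<comment> \<open>The bias outside \<open>T\<close> in units of \<sigma>. The residual of the data
    is \<sigma> times \<open>c + (y - orth_proj T y)\<close>, so \<open>s\<close> is the variance
    estimate and \<open>1 + \<rho> y\<close> the factor max 1 (4 \<beta> \<sigma>^2 / s).\<close>
  define c where "c = (\<mu> - orth_proj T \<mu>) /\<^sub>R \<sigma>"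
  define V where "V y = (norm (c + (y - orth_proj T y)))\<^sup>2" for y
  define s where "s y = \<sigma>\<^sup>2 * V y / ?N" for y
  define \<rho> where "\<rho> y = max 0 (4 * \<beta> * ?N / V y - 1)" for y
  have ph: "phi (4 * \<beta>) > 0" using \<beta> by (intro phi_pos) auto
  have N0: "?N > 0"
    using N ph n by (smt (verit) divide_nonneg_pos ln_gt_zero)
  have c0: "orth_proj T c = 0"
    unfolding c_def using orth_proj_nested[OF T(1) T(1), of \<mu>]
    by (simp add: orth_proj_scaleR[OF T(1)] linear_diff[OF linear_orth_proj[OF T(1)]])
  have "4 * \<beta> > 0" "4 * \<beta> < 1" using \<beta> by auto
  from excess_ratio[OF T(1) c0 this n N]
  have V: "AE y in std_gauss. V y > 0" and i\<rho>: "integrable std_gauss \<rho>"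
    and E\<rho>: "(\<integral>y. \<rho> y \<partial>std_gauss) \<le> 1 / (2 * n * ln n)"
    unfolding V_def \<rho>_def by simp_all
  have \<rho>0: "\<rho> y \<ge> 0" for y by (simp add: \<rho>_def)
  have res: "\<mu> + \<sigma> *\<^sub>R y - orth_proj T (\<mu> + \<sigma> *\<^sub>R y) = \<sigma> *\<^sub>R (c + (y - orth_proj T y))" for y
    using \<sigma> by (simp add: c_def orth_proj_add[OF T(1)] orth_proj_scaleR[OF T(1)] algebra_simps)
  have s_var: "s y = var_est T (\<mu> + \<sigma> *\<^sub>R y)" for y
    unfolding var_est_def res s_def V_def by (simp add: power_mult_distrib)
  have PU: "orth_proj UNIV y = y" for y :: "real ^ 'n"
    by (rule orth_proj_self) auto
  have dN: "real CARD('n) - real (dim T) = ?N"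
    using dim_subset_UNIV[of T] by (simp add: resid_dim_def of_nat_diff)
  have intS: "integrable std_gauss s" "(\<integral>y. s y \<partial>std_gauss) = \<sigma>bar2"
  proof -
    have e: "s = (\<lambda>y. ((norm (orth_proj UNIV (\<mu> + \<sigma> *\<^sub>R y)))\<^sup>2 - (norm (orth_proj T (\<mu> + \<sigma> *\<^sub>R y)))\<^sup>2) / ?N)"
      by (simp add: fun_eq_iff s_var var_est_def norm_diff_orth_proj[OF T(1)] PU)
    note i = std_gauss_orth_proj[OF T(1), of \<mu> \<sigma>] std_gauss_orth_proj[OF subspace_UNIV, of \<mu> \<sigma>]
    show "integrable std_gauss s" unfolding e using i by simp
    have "(\<integral>y. s y \<partial>std_gauss) = ((norm \<mu>)\<^sup>2 + \<sigma>\<^sup>2 * CARD('n) - ((norm (orth_proj T \<mu>))\<^sup>2 + \<sigma>\<^sup>2 * dim T)) / ?N"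
      unfolding e using i by (simp add: PU)
    also have "\<dots> = (?N * \<sigma>\<^sup>2 + (norm (\<mu> - orth_proj T \<mu>))\<^sup>2) / ?N"
      unfolding norm_diff_orth_proj[OF T(1)] dN[symmetric] by (simp add: algebra_simps)
    finally show "(\<integral>y. s y \<partial>std_gauss) = \<sigma>bar2"
      using N0 by (simp add: \<sigma>bar2_def add_divide_distrib)
  qed
  \<comment> \<open>The free energy is \<open>a + K / \<beta> * s y\<close>. Both coefficients are
    nonnegative: \<open>a\<close> because every \<open>S m\<close> lies in \<open>T\<close>,
    \<open>K\<close> because it is a relative entropy plus an average of nonnegative
    \<open>L m\<close>.\<close>
  define a where "a = (\<Sum>m\<in>M. \<pi> m * exp (k m) * ((norm (orth_proj T \<mu>))\<^sup>2 - (norm (orth_proj (S m) \<mu>))\<^sup>2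
            + \<sigma>\<^sup>2 * (real (dim T) - real (dim (S m)))))"
  define K where "K = (\<Sum>m\<in>M. \<pi> m * exp (k m) * (L m + k m))"
  have a0: "a \<ge> 0"
    unfolding a_def
  proof (intro sum_nonneg mult_nonneg_nonneg add_nonneg_nonneg)
    fix m assume m: "m \<in> M"
    show "\<pi> m \<ge> 0" using pi_nonneg m .
    show "0 \<le> (norm (orth_proj T \<mu>))\<^sup>2 - (norm (orth_proj (S m) \<mu>))\<^sup>2"
      using norm_orth_proj_le[OF sub[OF m], of "orth_proj T \<mu>"] orth_proj_nested[OF sub[OF m] T(1) T(2)[OF m]]
      by (simp add: power_mono)
    show "0 \<le> real (dim T) - real (dim (S m))" using dim_subset[OF T(2)[OF m]] by simp
  qed auto
  have K0: "K \<ge> 0"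
  proof -
    have "0 = (\<Sum>m\<in>M. \<pi> m * (exp (k m) - 1))"
      using k pi_sum by (simp add: right_diff_distrib sum_subtractf)
    also have "\<dots> \<le> (\<Sum>m\<in>M. \<pi> m * (exp (k m) * k m))"
      by (intro sum_mono mult_left_mono exp_mult_self_ge pi_nonneg)
    also have "\<dots> \<le> (\<Sum>m\<in>M. \<pi> m * exp (k m) * (L m + k m))"
    proof (rule sum_mono)
      fix m assume m: "m \<in> M"
      have "0 \<le> L m" using L[OF m] by (rule order_trans[rotated]) simp
      then have "0 \<le> \<pi> m * exp (k m) * L m" using pi_nonneg[OF m] by simp
      then show "\<pi> m * (exp (k m) * k m) \<le> \<pi> m * exp (k m) * (L m + k m)"
        by (simp add: algebra_simps)
    qed
    finally show ?thesis by (simp add: K_def)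
  qed
  define R where "R = (norm (\<mu> - orth_proj T \<mu>))\<^sup>2 - \<sigma>\<^sup>2 * dim T"
  \<comment> \<open>Linear in \<open>s\<close> and \<open>\<rho>\<close>, so its mean needs only
    their means and no information on their correlation.\<close>
  define U where "U y = R + a * (1 + \<rho> y) + K / \<beta> * (s y + \<sigma>bar2 * \<rho> y)" for y
  have fixed: "(\<integral>\<^sup>+x. ennreal ((norm (\<mu> - est (\<beta> / s y) (\<mu> + \<sigma> *\<^sub>R x)))\<^sup>2) \<partial>std_gauss) \<le> ennreal (U y) \<and> 0 \<le> U y"
    if "V y > 0" for y
  proof -
    have sy: "s y > 0" using that \<sigma> N0 by (simp add: s_def)
    let ?l = "\<lambda>x. (norm (\<mu> - est (\<beta> / s y) (\<mu> + \<sigma> *\<^sub>R x)))\<^sup>2"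
    have il: "integrable std_gauss ?l"
      by (rule integrable_std_gauss_quadratic[where A="8 * (norm \<mu>)\<^sup>2" and B="2 * \<sigma>\<^sup>2"])
         (measurable, simp add: loss_le[OF \<sigma>])
    have lam: "\<beta> / s y > 0" using \<beta> sy by simp
    have m1: "max 1 (4 * \<sigma>\<^sup>2 * (\<beta> / s y)) = 1 + \<rho> y"
      using \<sigma> N0 that by (simp add: s_def \<rho>_def max_def field_simps)
    \<comment> \<open>A nonzero excess forces \<open>V y < ?N\<close>, because \<beta> < 1/4; then
      \<open>s y\<close> is below \<sigma>^2 and so below its mean
      \<open>\<sigma>bar2\<close>.\<close>
    have \<rho>s: "\<rho> y * s y \<le> \<sigma>bar2 * \<rho> y"
    proof (cases "\<rho> y = 0")
      case False
      then have "1 < 4 * \<beta> * ?N / V y" by (intro not_le_imp_less notI) (simp add: \<rho>_def)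
      then have "V y < 4 * \<beta> * ?N" using that by (simp add: field_simps)
      moreover have "4 * \<beta> * ?N \<le> 1 * ?N" using \<beta> by (intro mult_right_mono) auto
      ultimately have "V y \<le> ?N" by linarith
      then have "V y / ?N \<le> 1" using N0 by simp
      then have "\<sigma>\<^sup>2 * V y / ?N \<le> \<sigma>\<^sup>2"
        using mult_left_mono[of "V y / ?N" 1 "\<sigma>\<^sup>2"] by simp
      moreover have "0 \<le> (norm (\<mu> - orth_proj T \<mu>))\<^sup>2 / ?N" by simp
      ultimately have "s y \<le> \<sigma>bar2" unfolding s_def \<sigma>bar2_def by linarith
      then have "\<rho> y * s y \<le> \<rho> y * \<sigma>bar2" by (rule mult_left_mono) (rule \<rho>0)
      then show ?thesis by (simp only: mult.commute)
    qed simp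
    have "(\<integral>x. ?l x \<partial>std_gauss) \<le> R + (1 + \<rho> y) * (a + K / \<beta> * s y)"
    proof -
      have eq: "(\<Sum>m\<in>M. \<pi> m * exp (k m) *
          ((norm (orth_proj T \<mu>))\<^sup>2 - (norm (orth_proj (S m) \<mu>))\<^sup>2
            + \<sigma>\<^sup>2 * (real (dim T) - real (dim (S m))) + (L m + k m) / (\<beta> / s y))) = a + K / \<beta> * s y"
        unfolding a_def K_def sum_divide_distrib sum_distrib_right sum.distrib[symmetric]
        by (intro sum.cong refl) (simp add: algebra_simps add_divide_distrib)
      from risk_fixed_temperature[OF T L lam \<sigma> k, of \<mu>] show ?thesis
        unfolding eq m1 R_def norm_diff_orth_proj[OF T(1)] by simp
    qed
    also have "\<dots> \<le> U y"
    proof -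
      have "K / \<beta> * (\<rho> y * s y) \<le> K / \<beta> * (\<sigma>bar2 * \<rho> y)"
        using K0 \<beta> by (intro mult_left_mono \<rho>s) auto
      then show ?thesis unfolding U_def by (simp add: algebra_simps add_divide_distrib)
    qed
    finally have le: "(\<integral>x. ?l x \<partial>std_gauss) \<le> U y" .
    moreover have "0 \<le> U y" by (rule order_trans[OF _ le]) simp
    moreover have "(\<integral>\<^sup>+x. ennreal (?l x) \<partial>std_gauss) = ennreal (\<integral>x. ?l x \<partial>std_gauss)"
      by (rule nn_integral_eq_integral[OF il]) simp
    ultimately show ?thesis by (simp add: ennreal_leI)
  qed
  \<comment> \<open>On the null set \<open>V y = 0\<close> the inverse temperature
    \<open>\<beta> / s y\<close> is only the default value 0, and no bound is claimed there.\<close>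
  have AE_le: "AE y in std_gauss. (\<integral>\<^sup>+x. ennreal ((norm (\<mu> - est (\<beta> / s y) (\<mu> + \<sigma> *\<^sub>R x)))\<^sup>2) \<partial>std_gauss) \<le> ennreal (U y)"
    and AE_nonneg: "AE y in std_gauss. 0 \<le> U y"
    using V by (eventually_elim, use fixed in blast)+
  have [measurable]: "V \<in> borel_measurable borel" unfolding V_def[abs_def] by measurable
  have [measurable]: "s \<in> borel_measurable borel" unfolding s_def[abs_def] by measurable
  have iU: "integrable std_gauss U"
    unfolding U_def[abs_def] using i\<rho> intS(1) by simp
  have lm: "loss \<in> borel_measurable borel"
    unfolding loss_def s_var[symmetric] by measurable
  show il: "integrable std_gauss loss"
    by (rule integrable_std_gauss_quadratic[OF lm, where A="8 * (norm \<mu>)\<^sup>2" and B="2 * \<sigma>\<^sup>2"])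
       (simp add: loss_def loss_le[OF \<sigma>])
  \<comment> \<open>The first slot receives the projection and drives the estimator, the second
    receives the residual and drives the temperature.\<close>
  define f where "f a b = ennreal ((norm (\<mu> - est (\<beta> / (\<sigma>\<^sup>2 * (norm (c + b))\<^sup>2 / ?N)) (\<mu> + \<sigma> *\<^sub>R a)))\<^sup>2)" for a b
  have [measurable]: "(\<lambda>(a, b). f a b) \<in> borel_measurable (borel \<Otimes>\<^sub>M borel)"
    unfolding f_def by measurable
  \<comment> \<open>Every \<open>S m\<close> lies in \<open>T\<close>, so the mixture sees only the
    projection of the data onto \<open>T\<close>. This lets the loss be split, and afterwards puts
    the full vector back so that the fixed-temperature bound applies.\<close>
  have estP: "est lam (\<mu> + \<sigma> *\<^sub>R orth_proj T x) = est lam (\<mu> + \<sigma> *\<^sub>R x)" for lam x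
  proof -
    have "orth_proj (S m) (\<mu> + \<sigma> *\<^sub>R orth_proj T x) = orth_proj (S m) (\<mu> + \<sigma> *\<^sub>R x)" if "m \<in> M" for m
      by (simp add: orth_proj_add orth_proj_scaleR orth_proj_nested sub that T)
    then show ?thesis unfolding est_def Z_def raw_def by (simp cong: sum.cong)
  qed
  have "(\<integral>\<^sup>+x. ennreal (loss x) \<partial>std_gauss) = (\<integral>\<^sup>+x. f (orth_proj T x) (x - orth_proj T x) \<partial>std_gauss)"
    unfolding f_def estP V_def[symmetric] s_def[symmetric] by (simp add: loss_def s_var)
  also have "\<dots> = (\<integral>\<^sup>+y. \<integral>\<^sup>+x. f (orth_proj T x) (y - orth_proj T y) \<partial>std_gauss \<partial>std_gauss)"
    by (rule nn_integral_std_gauss_split[OF T(1)]) measurable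
  also have "\<dots> = (\<integral>\<^sup>+y. \<integral>\<^sup>+x. ennreal ((norm (\<mu> - est (\<beta> / s y) (\<mu> + \<sigma> *\<^sub>R x)))\<^sup>2) \<partial>std_gauss \<partial>std_gauss)"
    unfolding f_def estP V_def[symmetric] s_def[symmetric] ..
  also have "\<dots> \<le> (\<integral>\<^sup>+y. ennreal (U y) \<partial>std_gauss)"
    by (rule nn_integral_mono_AE[OF AE_le])
  also have "\<dots> = ennreal (\<integral>y. U y \<partial>std_gauss)"
    by (rule nn_integral_eq_integral[OF iU AE_nonneg])
  finally have "ennreal (\<integral>x. loss x \<partial>std_gauss) \<le> ennreal (\<integral>y. U y \<partial>std_gauss)"
    by (subst nn_integral_eq_integral[OF il, symmetric]) (simp_all add: loss_def)
  moreover have "0 \<le> (\<integral>y. U y \<partial>std_gauss)"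
    by (rule integral_nonneg_AE[OF AE_nonneg])
  ultimately have "(\<integral>x. loss x \<partial>std_gauss) \<le> (\<integral>y. U y \<partial>std_gauss)"
    by simp
  also have "\<dots> = R + (1 + (\<integral>y. \<rho> y \<partial>std_gauss)) * (a + K / \<beta> * \<sigma>bar2)"
    unfolding U_def using i\<rho> intS prob_space by (simp add: algebra_simps add_divide_distrib)
  also have "\<dots> \<le> R + (1 + 1 / (2 * n * ln n)) * (a + K / \<beta> * \<sigma>bar2)"
  proof (intro add_left_mono mult_right_mono E\<rho>)
    have "\<sigma>bar2 \<ge> 0" by (simp add: \<sigma>bar2_def)
    then show "0 \<le> a + K / \<beta> * \<sigma>bar2" using a0 K0 \<beta> by simp
  qed
  also have "a + K / \<beta> * \<sigma>bar2 = (\<Sum>m\<in>M. \<pi> m * exp (k m) *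
          ((norm (orth_proj T \<mu>))\<^sup>2 - (norm (orth_proj (S m) \<mu>))\<^sup>2
            + \<sigma>\<^sup>2 * (real (dim T) - real (dim (S m))) + \<sigma>bar2 / \<beta> * (L m + k m)))"
    unfolding a_def K_def sum_divide_distrib sum_distrib_right sum.distrib[symmetric]
    by (intro sum.cong refl) (simp add: algebra_simps add_divide_distrib)
  finally show "(\<integral>x. loss x \<partial>std_gauss) \<le> (norm (\<mu> - orth_proj T \<mu>))\<^sup>2 - \<sigma>\<^sup>2 * dim T + (1 + 1 / (2 * n * ln n)) *
      (\<Sum>m\<in>M. \<pi> m * exp (k m) *
          ((norm (orth_proj T \<mu>))\<^sup>2 - (norm (orth_proj (S m) \<mu>))\<^sup>2
            + \<sigma>\<^sup>2 * (real (dim T) - real (dim (S m))) + \<sigma>bar2 / \<beta> * (L m + k m)))"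
    unfolding R_def .
qed

end

text \<open>Only a regrouping of the exponent; where the variance estimate vanishes, the default
  quotient 0 makes both sides agree as well.\<close>

lemma mixed_estimator_eq_est:
  assumes "gibbs_mixture M S \<pi>"
  shows "mixed_estimator T M S \<pi> L \<beta> y = gibbs_mixture.est M S \<pi> L (\<beta> / var_est T y) y"
proof -
  interpret gibbs_mixture M S \<pi> L by fact
  show ?thesis
    unfolding mixed_estimator_def est_def mix_weight_def raw_weight_def Z_def raw_def by simp
qed

text \<open>Integrability is part of the conclusion because the Bochner integral of a nonintegrable
  function is 0, which would empty the bounds of content. The second bound lives in
  \<open>ereal\<close>, where \<open>neg_log 0 = \<infinity>\<close> removes models of zero prior
  weight from the infimum.\<close>

theorem theorem1:
  fixes P :: "'w measure"
    and \<epsilon> Y :: "'w \<Rightarrow> real ^ 'n"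
    and \<mu> :: "real ^ 'n"
    and \<sigma> \<beta> \<epsilon>\<^sub>n \<sigma>bar2 :: real
    and M :: "'m set"
    and S :: "'m \<Rightarrow> (real ^ 'n) set"
    and Sstar :: "(real ^ 'n) set"
    and \<pi> L :: "'m \<Rightarrow> real"
    and n N :: nat
  assumes "prob_space P"
    and "n = CARD('n)" and "n \<ge> 3"
    and "\<sigma> > 0"
    and "standard_gaussian P \<epsilon>"
    and "\<And>\<omega>. Y \<omega> = \<mu> + \<sigma> *\<^sub>R \<epsilon> \<omega>"
    and "finite M"
    and "subspace Sstar" and "dim Sstar < n" and "N = n - dim Sstar"
    and "\<And>m. m \<in> M \<Longrightarrow> subspace (S m)"
    and "\<And>m. m \<in> M \<Longrightarrow> S m \<subseteq> Sstar"
    and "\<And>m. m \<in> M \<Longrightarrow> \<pi> m \<ge> 0" and "(\<Sum>m\<in>M. \<pi> m) = 1"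
    and "\<And>m. m \<in> M \<Longrightarrow> L m \<ge> 0"
    and "\<beta> > 0" and "\<beta> < 1 / 4"
    and "real N \<ge> 2 + ln (real n) / phi (4 * \<beta>)"
    and "\<And>m. m \<in> M \<Longrightarrow> L m \<ge> real (dim (S m)) / 2"
    and "\<epsilon>\<^sub>n = 1 / (2 * real n * ln (real n))"
    and "\<sigma>bar2 = \<sigma>\<^sup>2 + (norm (\<mu> - orth_proj Sstar \<mu>))\<^sup>2 / real N"
  shows "integrable P (\<lambda>\<omega>. (norm (\<mu> - mixed_estimator Sstar M S \<pi> L \<beta> (Y \<omega>)))\<^sup>2) \<and>
         prob_space.expectation P (\<lambda>\<omega>. (norm (\<mu> - mixed_estimator Sstar M S \<pi> L \<beta> (Y \<omega>)))\<^sup>2)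
         \<le> - (1 + \<epsilon>\<^sub>n) * (\<sigma>bar2 / \<beta>) *
             ln (\<Sum>m\<in>M. \<pi> m *
                  exp (- \<beta> * ((norm (\<mu> - orth_proj (S m) \<mu>))\<^sup>2 - real (dim (S m)) * \<sigma>\<^sup>2) / \<sigma>bar2
                       - L m))
           + \<sigma>\<^sup>2 / (2 * ln (real n)) \<and>
         ereal (prob_space.expectation P
                 (\<lambda>\<omega>. (norm (\<mu> - mixed_estimator Sstar M S \<pi> L \<beta> (Y \<omega>)))\<^sup>2))
         \<le> ereal (1 + \<epsilon>\<^sub>n) *
             (INF m\<in>M. ereal ((norm (\<mu> - orth_proj (S m) \<mu>))\<^sup>2)
                        + ereal (\<sigma>bar2 / \<beta>) * (ereal (L m) + neg_log (\<pi> m)))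
           + ereal (\<sigma>\<^sup>2 / (2 * ln (real n)))"
proof -
  interpret P: prob_space P by fact
  interpret gibbs_mixture M S \<pi> L
    using assms by unfold_locales auto
  have n: "real n > 1" "real n > 0" using assms(3) by auto
  have lnn: "ln (real n) > 0" using n by simp
  have NT: "resid_dim Sstar = N" by (simp add: resid_dim_def assms)
  have N: "real (resid_dim Sstar) \<ge> 2 + ln (real n) / phi (4 * \<beta>)"
    unfolding NT by (fact assms(18))
  let ?v = "\<lambda>x. var_est Sstar (\<mu> + \<sigma> *\<^sub>R x)"
  define loss where "loss x = (norm (\<mu> - est (\<beta> / ?v x) (\<mu> + \<sigma> *\<^sub>R x)))\<^sup>2" for x
  have loss: "(\<lambda>\<omega>. (norm (\<mu> - mixed_estimator Sstar M S \<pi> L \<beta> (Y \<omega>)))\<^sup>2) = (\<lambda>\<omega>. loss (\<epsilon> \<omega>))"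
    by (simp add: fun_eq_iff loss_def assms(6) mixed_estimator_eq_est[OF gibbs_mixture_axioms])
  define A where "A m = (norm (\<mu> - orth_proj (S m) \<mu>))\<^sup>2 - real (dim (S m)) * \<sigma>\<^sup>2" for m
  define W where "W = (\<Sum>m\<in>M. \<pi> m * exp (- \<beta> * A m / \<sigma>bar2 - L m))"
  have W: "W > 0" unfolding W_def by (rule sum_pi_exp_pos)
  \<comment> \<open>The optimal competitor: the Gibbs distribution of the first bound's logarithm,
    whose normalising constant is \<open>W\<close>.\<close>
  define k where "k m = - \<beta> * A m / \<sigma>bar2 - L m - ln W" for m
  have k: "(\<Sum>m\<in>M. \<pi> m * exp (k m)) = 1"
  proof -
    have "(\<Sum>m\<in>M. \<pi> m * exp (k m)) = (\<Sum>m\<in>M. \<pi> m * exp (- \<beta> * A m / \<sigma>bar2 - L m) / W)"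
      unfolding k_def using W by (intro sum.cong refl) (simp add: exp_diff[of _ "ln W"])
    then show ?thesis
      unfolding sum_divide_distrib[symmetric] W_def[symmetric] using W by simp
  qed
  have sb: "\<sigma>bar2 > 0"
    using assms(4) unfolding assms(21) by (simp add: add_pos_nonneg)
  have sb': "\<sigma>bar2 = \<sigma>\<^sup>2 + (norm (\<mu> - orth_proj Sstar \<mu>))\<^sup>2 / resid_dim Sstar"
    unfolding NT by (fact assms(21))
  have \<beta>: "\<beta> > 0" "\<beta> < 1 / 4" and \<sigma>: "\<sigma> > 0" by fact+
  have L: "\<And>m. m \<in> M \<Longrightarrow> L m \<ge> real (dim (S m)) / 2" by fact
  note sub' = \<open>subspace Sstar\<close> \<open>\<And>m. m \<in> M \<Longrightarrow> S m \<subseteq> Sstar\<close>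
  note main = expected_loss_le[OF sub' L \<sigma> \<beta> n(1) N k, of \<mu>, folded sb' loss_def]
  have il: "integrable std_gauss loss"
    using main(1) by (simp add: loss_def[abs_def])
  have \<epsilon>m: "\<epsilon> \<in> borel_measurable P" and d\<epsilon>: "distr P borel \<epsilon> = std_gauss"
    using distr_standard_gaussian[OF assms(1) assms(5)] by simp_all
  have lm: "loss \<in> borel_measurable borel"
    using borel_measurable_integrable[OF il] by simp
  have iP: "integrable P (\<lambda>\<omega>. loss (\<epsilon> \<omega>))"
    using il unfolding d\<epsilon>[symmetric] by (subst (asm) integrable_distr_eq[OF \<epsilon>m lm])
  have EP: "(\<integral>\<omega>. loss (\<epsilon> \<omega>) \<partial>P) = (\<integral>x. loss x \<partial>std_gauss)"
    unfolding d\<epsilon>[symmetric] by (rule integral_distr[OF \<epsilon>m lm, symmetric])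
  let ?c = "(norm (\<mu> - orth_proj Sstar \<mu>))\<^sup>2 - \<sigma>\<^sup>2 * dim Sstar"
  let ?\<delta> = "\<sigma>\<^sup>2 / (2 * ln (real n))"
  have e0: "\<epsilon>\<^sub>n > 0" using n lnn by (simp add: assms(20))
  have sum: "(\<Sum>m\<in>M. \<pi> m * exp (k m) *
          ((norm (orth_proj Sstar \<mu>))\<^sup>2 - (norm (orth_proj (S m) \<mu>))\<^sup>2
            + \<sigma>\<^sup>2 * (real (dim Sstar) - real (dim (S m))) + \<sigma>bar2 / \<beta> * (L m + k m)))
      = - (\<sigma>bar2 / \<beta>) * ln W - ?c"
  proof -
    \<comment> \<open>For this \<open>k\<close> the bracket does not depend on \<open>m\<close>,
      because the terms depending on the model cancel against \<open>A m\<close>; averaging is then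
      trivial.\<close>
    have "(norm (orth_proj Sstar \<mu>))\<^sup>2 - (norm (orth_proj (S m) \<mu>))\<^sup>2
            + \<sigma>\<^sup>2 * (real (dim Sstar) - real (dim (S m))) + \<sigma>bar2 / \<beta> * (L m + k m)
        = - (\<sigma>bar2 / \<beta>) * ln W - ?c" if m: "m \<in> M" for m
    proof -
      have "\<sigma>bar2 / \<beta> * (L m + k m) = - A m - \<sigma>bar2 / \<beta> * ln W"
        using sb \<beta> by (simp add: k_def field_simps)
      then show ?thesis
        by (simp add: A_def norm_diff_orth_proj[OF sub'(1)] norm_diff_orth_proj[OF sub[OF m]] algebra_simps)
    qed
    then have "(\<Sum>m\<in>M. \<pi> m * exp (k m) *
          ((norm (orth_proj Sstar \<mu>))\<^sup>2 - (norm (orth_proj (S m) \<mu>))\<^sup>2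
            + \<sigma>\<^sup>2 * (real (dim Sstar) - real (dim (S m))) + \<sigma>bar2 / \<beta> * (L m + k m)))
      = (\<Sum>m\<in>M. \<pi> m * exp (k m) * (- (\<sigma>bar2 / \<beta>) * ln W - ?c))"
      by (intro sum.cong refl) simp
    then show ?thesis by (simp only: sum_distrib_right[symmetric] k mult_1)
  qed
  have first: "(\<integral>\<omega>. loss (\<epsilon> \<omega>) \<partial>P) \<le> - (1 + \<epsilon>\<^sub>n) * (\<sigma>bar2 / \<beta>) * ln W + ?\<delta>"
  proof -
    have "(\<integral>\<omega>. loss (\<epsilon> \<omega>) \<partial>P) \<le> ?c + (1 + \<epsilon>\<^sub>n) * (- (\<sigma>bar2 / \<beta>) * ln W - ?c)"
      unfolding EP using main(2) unfolding sum assms(20) by simp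
    also have "\<dots> = - (1 + \<epsilon>\<^sub>n) * (\<sigma>bar2 / \<beta>) * ln W + - \<epsilon>\<^sub>n * ?c"
      by (simp add: algebra_simps add_divide_distrib)
    \<comment> \<open>The offset \<open>?c\<close> enters once with coefficient 1 and once with
      \<open>- (1 + \<epsilon>\<^sub>n)\<close>. What remains is paid by
      \<open>- ?c \<le> \<sigma>\<^sup>2 * real n\<close>, and n \<epsilon>_n = 1 / (2 log
      n).\<close>
    also have "- \<epsilon>\<^sub>n * ?c \<le> ?\<delta>"
    proof -
      have "- ?c \<le> \<sigma>\<^sup>2 * real n"
      proof -
        have "\<sigma>\<^sup>2 * dim Sstar \<le> \<sigma>\<^sup>2 * real n"
          using \<open>dim Sstar < n\<close> by (intro mult_left_mono) auto
        then show ?thesis using zero_le_power2[of "norm (\<mu> - orth_proj Sstar \<mu>)"] by linarith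
      qed
      then have "\<epsilon>\<^sub>n * (- ?c) \<le> \<epsilon>\<^sub>n * (\<sigma>\<^sup>2 * real n)"
        using e0 by (intro mult_left_mono) auto
      also have "\<dots> = ?\<delta>" using n by (simp add: assms(20))
      finally show ?thesis by (simp only: mult_minus_left mult_minus_right)
    qed
    finally show ?thesis by simp
  qed
  let ?E = "\<integral>\<omega>. loss (\<epsilon> \<omega>) \<partial>P"
  let ?B = "\<lambda>m. ereal ((norm (\<mu> - orth_proj (S m) \<mu>))\<^sup>2)
                        + ereal (\<sigma>bar2 / \<beta>) * (ereal (L m) + neg_log (\<pi> m))"
  \<comment> \<open>The second bound solved for the infimum, so that each model can be compared
    separately.\<close>
  define X where "X = (?E - ?\<delta>) / (1 + \<epsilon>\<^sub>n)"
  have X: "X \<le> - (\<sigma>bar2 / \<beta>) * ln W"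
    unfolding X_def using first e0 by (simp add: pos_divide_le_eq algebra_simps add_divide_distrib)
  \<comment> \<open>A model of zero prior weight contributes \<infinity>; otherwise its single
    summand bounds \<open>W\<close> from below.\<close>
  have XB: "ereal X \<le> ?B m" if m: "m \<in> M" for m
  proof (cases "\<pi> m = 0")
    case True
    then show ?thesis using sb \<beta> by (simp add: neg_log_def)
  next
    case False
    then have p: "\<pi> m > 0" using pi_nonneg[OF m] by simp
    have "\<pi> m * exp (- \<beta> * A m / \<sigma>bar2 - L m) \<le> W"
      unfolding W_def using pi_nonneg by (intro member_le_sum m fin) auto
    then have "ln (\<pi> m * exp (- \<beta> * A m / \<sigma>bar2 - L m)) \<le> ln W"
      using p by (intro ln_mono) auto
    then have "ln (\<pi> m) + (- \<beta> * A m / \<sigma>bar2 - L m) \<le> ln W"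
      using p by (simp add: ln_mult)
    then have "- (\<sigma>bar2 / \<beta>) * ln W \<le> - (\<sigma>bar2 / \<beta>) * (ln (\<pi> m) + (- \<beta> * A m / \<sigma>bar2 - L m))"
      using sb \<beta> by (intro mult_left_mono_neg) auto
    also have "\<dots> = A m + \<sigma>bar2 / \<beta> * (L m - ln (\<pi> m))"
      using sb \<beta> by (simp add: field_simps)
    also have "\<dots> \<le> (norm (\<mu> - orth_proj (S m) \<mu>))\<^sup>2 + \<sigma>bar2 / \<beta> * (L m - ln (\<pi> m))"
      by (simp add: A_def)
    finally show ?thesis using X False by (simp add: neg_log_def)
  qed
  have "ereal ?E = ereal (1 + \<epsilon>\<^sub>n) * ereal X + ereal ?\<delta>"
    using e0 by (simp add: X_def)
  also have "\<dots> \<le> ereal (1 + \<epsilon>\<^sub>n) * (INF m\<in>M. ?B m) + ereal ?\<delta>"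
    using e0 by (intro add_right_mono ereal_mult_left_mono INF_greatest XB) auto
  finally have second: "ereal ?E \<le> ereal (1 + \<epsilon>\<^sub>n) * (INF m\<in>M. ?B m) + ereal ?\<delta>" .
  show ?thesis
    unfolding loss using iP first second unfolding W_def A_def by blast
qed

end
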